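(* Let $(M,g)$ be a generalized Kantowski-Sachs spacetime with metric $$g=dt^{2}-X^{2}(t)\,dr^{2}-Y^{2}(t)\,[d\theta^{2}+f^{2}(\theta)\,d\phi^{2}]$$ with respect to the local coordinates $(t,r,\theta,\phi)$, and let $$\widehat g=dt^{2}-\widehat X^{2}(t)\,dr^{2}-\widehat Y^{2}(t)\,[d\theta^{2}+\widehat f^{2}(\theta)\,d\phi^{2}]$$ be another metric of the same type on $M$ in the same coordinates, where $X,Y,f,\widehat X,\widehat Y,\widehat f$ are smooth functions. Then the complete lift metric ${}^{C}\widehat g$ on the tangent bundle $TM$ is harmonic with respect to the complete lift metric ${}^{C}g$ on $TM$ if and only if $$\frac{1}{X^{2}}(\widehat X'\widehat X-X'X)+\frac{1}{Y^{2}}(\widehat Y'\widehat Y-Y'Y)+\frac{1}{Y^{2}f^{2}}(\widehat Y'\widehat Y\widehat f^{2}-Y'Yf^{2})=0$$ and $$-\widehat f\,\widehat f'+f f'=0.$$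
   Context: All objects are smooth. $M$ is a 4-dimensional manifold with coordinates $(t,r,\theta,\phi)$, and $g,\widehat g$ are pseudo-Riemannian (hence nondegenerate) metrics, so $X,Y,f,\widehat X,\widehat Y,\widehat f$ are nowhere zero on the coordinate domain. Primes denote derivatives: $X',Y',\widehat X',\widehat Y'$ with respect to $t$, and $f',\widehat f'$ with respect to $\theta$. For a map $F:(M,g_1)\to(N,g_2)$ of pseudo-Riemannian manifolds, the tension field is, in local coordinates, $$\tau(F)=g_1^{ij}\Big\{\frac{\partial^2F^\gamma}{\partial x^i\partial x^j}-{}^{M}\Gamma_{ij}^k\frac{\partial F^\gamma}{\partial x^k}+{}^{N}\Gamma_{\alpha\beta}^\gamma\frac{\partial F^\alpha}{\partial x^i}\frac{\partial F^\beta}{\partial x^j}\Big\}\frac{\partial}{\partial y^\gamma},$$ where ${}^{M}\Gamma$ and ${}^{N}\Gamma$ are the Christoffel symbols of the Levi-Civita connections of $g_1$ and $g_2$; $F$ is harmonic if $\tau(F)=0$. A pseudo-Riemannian metric $d$ on a pseudo-Riemannian manifold $(N,h)$ is called harmonic with respect to $h$ if the identity map $I:(N,h)\to(N,d)$ is harmonic. Complete lifts: for a 1-form $\omega$ on $M$, let $\imath\omega:TM\to\mathbb{R}$ be $\imath\omega(p,u)=\omega_p(u)$. The complete lift of a function $h$ on $M$ is $h^C=\imath(dh)$. The complete lift of a vector field $Z$ on $M$ is the vector field $Z^C$ on $TM$ determined by $Z^C(h^C)=(Zh)^C$ for all functions $h$ on $M$. The complete lift ${}^{C}g$ of a pseudo-Riemannian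 metric $g$ on $M$ is the metric on $TM$ defined by ${}^{C}g(Z^C,W^C)=(g(Z,W))^C$ for all vector fields $Z,W$ on $M$. Coordinates $(x^i)$ on $U\subset M$ induce coordinates $(x^i,u^i)$ on $\pi^{-1}(U)\subset TM$, where $u^i$ are the components of tangent vectors with respect to $\partial/\partial x^i$; in these coordinates $${}^{C}g=\begin{pmatrix} u^k\frac{\partial g_{ij}}{\partial x^k} & g_{ij}\\ g_{ij} & 0\end{pmatrix}.$$ The metric ${}^{C}\widehat g$ is the complete lift of $\widehat g$, defined in the same way from $\widehat g$. *)

theory Defs
  imports "HOL-Analysis.Analysis"
begin

text \<open>
  Everything is expressed in one coordinate chart: a manifold is an open set \<open>U\<close> of
  \<open>real ^ 'n\<close>, and a tensor field is the array of its components, as a function of the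
  coordinates.  Values of these functions outside \<open>U\<close> are irrelevant.
\<close>

section \<open>Smooth functions and metrics\<close>

primrec Ck_on :: "nat \<Rightarrow> 'a::real_normed_vector set \<Rightarrow> ('a \<Rightarrow> 'b::real_normed_vector) \<Rightarrow> bool" where
  "Ck_on 0 S F \<longleftrightarrow> continuous_on S F"
| "Ck_on (Suc k) S F \<longleftrightarrow>
     (\<forall>x\<in>S. F differentiable at x) \<and> (\<forall>v. Ck_on k S (\<lambda>x. frechet_derivative F (at x) v))"

text \<open>Meant for open \<open>S\<close> only, since the derivatives are not taken within \<open>S\<close>.\<close>

definition smooth_on :: "'a::real_normed_vector set \<Rightarrow> ('a \<Rightarrow> 'b::real_normed_vector) \<Rightarrow> bool" where
  "smooth_on S F \<longleftrightarrow> (\<forall>k. Ck_on k S F)"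

definition partial :: "'n \<Rightarrow> (real ^ 'n \<Rightarrow> real) \<Rightarrow> real ^ 'n \<Rightarrow> real" where
  "partial i F x = frechet_derivative F (at x) (axis i 1)"

text \<open>The signature is automatically constant on each connected component of \<open>U\<close>.\<close>

definition pseudo_riemannian_on :: "(real ^ 'n) set \<Rightarrow> (real ^ 'n \<Rightarrow> real ^ 'n ^ 'n) \<Rightarrow> bool" where
  "pseudo_riemannian_on U g \<longleftrightarrow>
     smooth_on U g \<and> (\<forall>x\<in>U. transpose (g x) = g x \<and> invertible (g x))"

definition metric_apply ::
  "(real ^ 'n \<Rightarrow> real ^ 'n ^ 'n) \<Rightarrow> (real ^ 'n \<Rightarrow> real ^ 'n) \<Rightarrow> (real ^ 'n \<Rightarrow> real ^ 'n) \<Rightarrow> real ^ 'n \<Rightarrow> real"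
  where "metric_apply g Z W x = (\<Sum>i\<in>UNIV. \<Sum>j\<in>UNIV. g x $ i $ j * Z x $ i * W x $ j)"

section \<open>Harmonic maps and harmonic metrics\<close>

text \<open>\<open>christoffel g k i j\<close> has the upper index \<open>k\<close> and the lower indices \<open>i\<close>, \<open>j\<close>.\<close>

definition christoffel :: "(real ^ 'n \<Rightarrow> real ^ 'n ^ 'n) \<Rightarrow> 'n \<Rightarrow> 'n \<Rightarrow> 'n \<Rightarrow> real ^ 'n \<Rightarrow> real" where
  "christoffel g k i j x =
     (1/2) * (\<Sum>l\<in>UNIV. matrix_inv (g x) $ k $ l *
        (partial i (\<lambda>y. g y $ j $ l) x + partial j (\<lambda>y. g y $ i $ l) x
           - partial l (\<lambda>y. g y $ i $ j) x))"

definition tension_field ::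
  "(real ^ 'm \<Rightarrow> real ^ 'm ^ 'm) \<Rightarrow> (real ^ 'n \<Rightarrow> real ^ 'n ^ 'n) \<Rightarrow> (real ^ 'm \<Rightarrow> real ^ 'n)
     \<Rightarrow> real ^ 'm \<Rightarrow> real ^ 'n" where
  "tension_field g1 g2 F x =
     (\<chi> c. \<Sum>i\<in>UNIV. \<Sum>j\<in>UNIV. matrix_inv (g1 x) $ i $ j *
        (partial i (partial j (\<lambda>y. F y $ c)) x
         - (\<Sum>k\<in>UNIV. christoffel g1 k i j x * partial k (\<lambda>y. F y $ c) x)
         + (\<Sum>a\<in>UNIV. \<Sum>b\<in>UNIV. christoffel g2 c a b (F x)
              * partial i (\<lambda>y. F y $ a) x * partial j (\<lambda>y. F y $ b) x)))"

definition harmonic_map_on ::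
  "(real ^ 'm) set \<Rightarrow> (real ^ 'm \<Rightarrow> real ^ 'm ^ 'm) \<Rightarrow> (real ^ 'n \<Rightarrow> real ^ 'n ^ 'n)
     \<Rightarrow> (real ^ 'm \<Rightarrow> real ^ 'n) \<Rightarrow> bool" where
  "harmonic_map_on U g1 g2 F \<longleftrightarrow> (\<forall>x\<in>U. tension_field g1 g2 F x = 0)"

text \<open>\<open>harmonic_metric_on U h d\<close>: the metric \<open>d\<close> is harmonic with respect to \<open>h\<close>.\<close>

definition harmonic_metric_on ::
  "(real ^ 'n) set \<Rightarrow> (real ^ 'n \<Rightarrow> real ^ 'n ^ 'n) \<Rightarrow> (real ^ 'n \<Rightarrow> real ^ 'n ^ 'n) \<Rightarrow> bool" where
  "harmonic_metric_on U h d \<longleftrightarrow> harmonic_map_on U h d (\<lambda>x. x)"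

section \<open>Complete lifts\<close>

text \<open>
  The induced coordinates \<open>(x\<^sup>i, u\<^sup>i)\<close> of the tangent bundle are indexed by \<open>'n + 'n\<close>:
  \<open>x\<^sup>i\<close> is the coordinate \<open>Inl i\<close> and \<open>u\<^sup>i\<close> is the coordinate \<open>Inr i\<close>.
\<close>

definition base_point :: "real ^ ('n + 'n) \<Rightarrow> real ^ 'n" where
  "base_point w = (\<chi> i. w $ Inl i)"

definition fibre_vector :: "real ^ ('n + 'n) \<Rightarrow> real ^ 'n" where
  "fibre_vector w = (\<chi> i. w $ Inr i)"

definition tangent_bundle :: "(real ^ 'n) set \<Rightarrow> (real ^ ('n + 'n)) set" where
  "tangent_bundle U = {w. base_point w \<in> U}"

definition iota :: "(real ^ 'n \<Rightarrow> real ^ 'n \<Rightarrow> real) \<Rightarrow> real ^ ('n + 'n) \<Rightarrow> real" where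
  "iota \<omega> w = \<omega> (base_point w) (fibre_vector w)"

definition complete_lift_fun :: "(real ^ 'n \<Rightarrow> real) \<Rightarrow> real ^ ('n + 'n) \<Rightarrow> real" where
  "complete_lift_fun h = iota (\<lambda>x. frechet_derivative h (at x))"

definition vf_apply :: "(real ^ 'n \<Rightarrow> real ^ 'n) \<Rightarrow> (real ^ 'n \<Rightarrow> real) \<Rightarrow> real ^ 'n \<Rightarrow> real" where
  "vf_apply Z h x = frechet_derivative h (at x) (Z x)"

definition is_complete_lift_field ::
  "(real ^ 'n) set \<Rightarrow> (real ^ 'n \<Rightarrow> real ^ 'n) \<Rightarrow> (real ^ ('n + 'n) \<Rightarrow> real ^ ('n + 'n)) \<Rightarrow> bool" where
  "is_complete_lift_field U Z ZC \<longleftrightarrow>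
     smooth_on (tangent_bundle U) ZC \<and>
     (\<forall>h. smooth_on U h \<longrightarrow>
        (\<forall>w\<in>tangent_bundle U.
           vf_apply ZC (complete_lift_fun h) w = complete_lift_fun (vf_apply Z h) w))"

text \<open>
  On the zero section the complete lifts of vector fields do not span the tangent spaces of the
  tangent bundle; there the lifted metric is determined by its smoothness.
\<close>

definition is_complete_lift_metric ::
  "(real ^ 'n) set \<Rightarrow> (real ^ 'n \<Rightarrow> real ^ 'n ^ 'n)
     \<Rightarrow> (real ^ ('n + 'n) \<Rightarrow> real ^ ('n + 'n) ^ ('n + 'n)) \<Rightarrow> bool" where
  "is_complete_lift_metric U g G \<longleftrightarrow>
     pseudo_riemannian_on (tangent_bundle U) G \<and>
     (\<forall>Z W ZC WC. smooth_on U Z \<longrightarrow> smooth_on U W \<longrightarrow>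
        is_complete_lift_field U Z ZC \<longrightarrow> is_complete_lift_field U W WC \<longrightarrow>
        (\<forall>w\<in>tangent_bundle U.
           metric_apply G ZC WC w = complete_lift_fun (metric_apply g Z W) w))"

section \<open>Generalized Kantowski-Sachs metrics\<close>

text \<open>The coordinates \<open>(t, r, \<theta>, \<phi>)\<close> are \<open>x $ 1\<close>, \<open>x $ 2\<close>, \<open>x $ 3\<close>, \<open>x $ 4\<close>.\<close>

definition gks_metric ::
  "(real \<Rightarrow> real) \<Rightarrow> (real \<Rightarrow> real) \<Rightarrow> (real \<Rightarrow> real) \<Rightarrow> real ^ 4 \<Rightarrow> real ^ 4 ^ 4" where
  "gks_metric X Y f x =
     (\<chi> i j. if i \<noteq> j then 0
            else if i = 1 then 1
            else if i = 2 then - (X (x $ 1))\<^sup>2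
            else if i = 3 then - (Y (x $ 1))\<^sup>2
            else - (Y (x $ 1))\<^sup>2 * (f (x $ 3))\<^sup>2)"

section \<open>Existence of complete lifts\<close>

text \<open>
  The two notions of complete lift are not vacuous.  The lift of a smooth vector field has the
  components \<open>(Z\<^sup>i, u\<^sup>k \<partial>\<^sub>k Z\<^sup>i)\<close>, and a lift of a metric is given by the block matrix with the blocks
  \<open>u\<^sup>k \<partial>\<^sub>k g\<^sub>i\<^sub>j\<close>, \<open>g\<^sub>i\<^sub>j\<close>, \<open>g\<^sub>i\<^sub>j\<close>, \<open>0\<close>.
\<close>

abbreviation (input) D_at where "D_at F x \<equiv> frechet_derivative F (at x)"

lemma D_works: "F differentiable at x \<Longrightarrow> (F has_derivative D_at F x) (at x)"
  by (simp add: frechet_derivative_works)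

lemma D_eq: "(F has_derivative F') (at x) \<Longrightarrow> D_at F x = F'"
  by (metis frechet_derivative_at)

lemma Ck_on_cong:
  assumes "open S" "\<And>x. x \<in> S \<Longrightarrow> F x = G x" "Ck_on k S F"
  shows "Ck_on k S G"
  using assms
proof (induction k arbitrary: F G)
  case 0 then show ?case by (metis Ck_on.simps(1) continuous_on_cong)
next
  case (Suc k)
  have d: "G differentiable at x" if "x \<in> S" for x
  proof -
    have "(F has_derivative D_at F x) (at x)" using Suc.prems that by (simp add: D_works)
    from has_derivative_transform_within_open[OF this \<open>open S\<close> that] show ?thesis
      using Suc.prems by (auto simp: differentiable_def)
  qed
  have e: "D_at F x = D_at G x" if "x \<in> S" for x
    using frechet_derivative_transform_within_open[of F x S G] Suc.prems that by auto
  have "Ck_on k S (\<lambda>x. D_at G x v)" for v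
    using Suc.IH[of "\<lambda>x. D_at F x v" "\<lambda>x. D_at G x v"] Suc.prems e by auto
  with d show ?case by auto
qed

lemma Ck_on_Suc_imp: "Ck_on (Suc k) S F \<Longrightarrow> Ck_on k S F"
proof (induction k arbitrary: F)
  case 0 then show ?case
    by (auto simp: continuous_at_imp_continuous_on differentiable_imp_continuous_within)
next
  case (Suc k) 
  show ?case using Suc.prems Suc.IH by (auto simp: Ck_on.simps(2)[of k])
qed

lemma Ck_on_const: "Ck_on k S (\<lambda>x. c)"
  by (induction k arbitrary: c) auto

lemma Ck_on_add:
  assumes "open S" "Ck_on k S F" "Ck_on k S G" shows "Ck_on k S (\<lambda>x. F x + G x)"
  using assms(2,3)
proof (induction k arbitrary: F G)
  case 0 then show ?case by (auto intro: continuous_intros)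
next
  case (Suc k)
  have e: "D_at (\<lambda>x. F x + G x) x = (\<lambda>v. D_at F x v + D_at G x v)" if "x \<in> S" for x
    by (rule D_eq) (use Suc.prems that in \<open>auto intro!: derivative_eq_intros D_works\<close>)
  have "Ck_on k S (\<lambda>x. D_at (\<lambda>x. F x + G x) x v)" for v
    by (rule Ck_on_cong[OF \<open>open S\<close> _ Suc.IH[of "\<lambda>x. D_at F x v" "\<lambda>x. D_at G x v"]])
      (use Suc.prems in \<open>auto simp: e\<close>)
  then show ?case using Suc.prems by auto
qed

lemma Ck_on_sum:
  assumes "open S" "\<And>i. i \<in> I \<Longrightarrow> Ck_on k S (F i)" shows "Ck_on k S (\<lambda>x. \<Sum>i\<in>I. F i x)"
  using assms by (induction I rule: infinite_finite_induct) (auto simp: Ck_on_const Ck_on_add)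

lemma Ck_on_bilinear:
  assumes B: "bounded_bilinear B" and "open S" "Ck_on k S F" "Ck_on k S G"
  shows "Ck_on k S (\<lambda>x. B (F x) (G x))"
  using assms(3,4)
proof (induction k arbitrary: F G)
  case 0 then show ?case using bounded_bilinear.continuous_on[OF B] by auto
next
  case (Suc k)
  have e: "((\<lambda>x. B (F x) (G x)) has_derivative (\<lambda>v. B (F x) (D_at G x v) + B (D_at F x v) (G x))) (at x)" if "x \<in> S" for x
    by (rule bounded_bilinear.FDERIV[OF B]) (use Suc.prems that in \<open>auto intro!: D_works\<close>)
  have "Ck_on k S (\<lambda>x. D_at (\<lambda>x. B (F x) (G x)) x v)" for v
  proof (rule Ck_on_cong[OF \<open>open S\<close>])
    show "Ck_on k S (\<lambda>x. B (F x) (D_at G x v) + B (D_at F x v) (G x))"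
      using Suc.prems by (intro Ck_on_add \<open>open S\<close> Suc.IH) (auto intro: Ck_on_Suc_imp)
  qed (simp add: D_eq[OF e])
  then show ?case using e by (auto simp: differentiable_def)
qed

lemma Ck_on_linear:
  assumes L: "bounded_linear L" and "open S" "Ck_on k S F"
  shows "Ck_on k S (\<lambda>x. L (F x))"
  using assms(3)
proof (induction k arbitrary: F)
  case 0 then show ?case using bounded_linear.continuous_on[OF L] by auto
next
  case (Suc k)
  have e: "((\<lambda>x. L (F x)) has_derivative (\<lambda>v. L (D_at F x v))) (at x)" if "x \<in> S" for x
    by (rule bounded_linear.has_derivative[OF L]) (use Suc.prems that in \<open>auto intro!: D_works\<close>)
  have "Ck_on k S (\<lambda>x. D_at (\<lambda>x. L (F x)) x v)" for v
    by (rule Ck_on_cong[OF \<open>open S\<close> _ Suc.IH[of "\<lambda>x. D_at F x v"]]) (use Suc.prems in \<open>auto simp: D_eq[OF e]\<close>)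
  then show ?case using e by (auto simp: differentiable_def)
qed

lemma Ck_on_compose_linear:
  assumes L: "bounded_linear L" and S: "open S" and "Ck_on k S F"
  shows "Ck_on k (L -` S) (\<lambda>x. F (L x))"
  using assms(3)
proof (induction k arbitrary: F)
  case 0 then show ?case
    using continuous_on_compose2[of S F "L -` S" L] linear_continuous_on[OF L] by auto
next
  case (Suc k)
  have o: "open (L -` S)" using L S by (simp add: linear_continuous_at open_vimage continuous_at_imp_continuous_on)
  have e: "((\<lambda>x. F (L x)) has_derivative (\<lambda>v. D_at F (L x) (L v))) (at x)" if "x \<in> L -` S" for x
    using diff_chain_at[of L L x F "D_at F (L x)"] Suc.prems that D_works[of F "L x"]
    by (auto simp: o_def bounded_linear_imp_has_derivative L)
  have "Ck_on k (L -` S) (\<lambda>x. D_at (\<lambda>x. F (L x)) x v)" for v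
    by (rule Ck_on_cong[OF o _ Suc.IH[of "\<lambda>x. D_at F x (L v)"]]) (use Suc.prems in \<open>auto simp: D_eq[OF e]\<close>)
  then show ?case using e by (auto simp: differentiable_def)
qed

lemma Ck_on_ident_linear:
  assumes L: "bounded_linear L" shows "Ck_on k S L"
proof (cases k)
  case 0 then show ?thesis by (simp add: L linear_continuous_on)
next
  case (Suc j)
  have d: "(L has_derivative L) (at x)" for x by (simp add: bounded_linear_imp_has_derivative L)
  have "Ck_on j S (\<lambda>x. D_at L x v)" for v unfolding D_eq[OF d] by (rule Ck_on_const)
  then show ?thesis using Suc d by (auto simp: differentiable_def)
qed

lemma second_difference:
  fixes h :: "'a::real_normed_vector \<Rightarrow> real"
  assumes "0 < t" and U: "\<And>s r. \<bar>s\<bar> \<le> t \<Longrightarrow> \<bar>r\<bar> \<le> t \<Longrightarrow> p + s *\<^sub>R v + r *\<^sub>R w \<in> U"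
    and h: "Ck_on 2 U h"
  shows "\<exists>\<xi> \<eta>. \<bar>\<xi>\<bar> \<le> t \<and> \<bar>\<eta>\<bar> \<le> t \<and>
     h (p + t *\<^sub>R v + t *\<^sub>R w) - h (p + t *\<^sub>R v) - h (p + t *\<^sub>R w) + h p
       = t * t * D_at (\<lambda>x. D_at h x v) (p + \<xi> *\<^sub>R v + \<eta> *\<^sub>R w) w"
proof -
  have dh: "h differentiable at x" if "x \<in> U" for x using h that by (simp add: numeral_2_eq_2)
  have d2: "(\<lambda>x. D_at h x v) differentiable at x" if "x \<in> U" for x v using h that by (simp add: numeral_2_eq_2)
  have lin: "D_at F x (c *\<^sub>R y) = c *\<^sub>R D_at F x y" if "F differentiable at x" for F :: "'a \<Rightarrow> real" and x y c
    using linear_frechet_derivative[OF that] by (simp add: linear_cmul)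
  have c1: "((\<lambda>s. h (p + s *\<^sub>R v + r *\<^sub>R w)) has_real_derivative D_at h (p + s *\<^sub>R v + r *\<^sub>R w) v) (at s)"
    if "\<bar>s\<bar> \<le> t" "\<bar>r\<bar> \<le> t" for s r
  proof -
    have "((\<lambda>s. p + s *\<^sub>R v + r *\<^sub>R w) has_derivative (\<lambda>c. c *\<^sub>R v)) (at s)"
      by (auto intro!: derivative_eq_intros)
    from diff_chain_at[OF this D_works[OF dh[OF U[OF that]]]]
    show ?thesis by (simp add: has_field_derivative_def o_def lin dh U that mult_commute_abs)
  qed
  have c2: "((\<lambda>r. D_at h (p + s *\<^sub>R v + r *\<^sub>R w) v) has_real_derivative D_at (\<lambda>x. D_at h x v) (p + s *\<^sub>R v + r *\<^sub>R w) w) (at r)"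
    if "\<bar>s\<bar> \<le> t" "\<bar>r\<bar> \<le> t" for s r
  proof -
    have "((\<lambda>r. p + s *\<^sub>R v + r *\<^sub>R w) has_derivative (\<lambda>c. c *\<^sub>R w)) (at r)"
      by (auto intro!: derivative_eq_intros)
    from diff_chain_at[OF this D_works[OF d2[OF U[OF that]]]]
    show ?thesis by (simp add: has_field_derivative_def o_def lin d2 U that mult_commute_abs)
  qed
  define F where "F s = h (p + s *\<^sub>R v + t *\<^sub>R w) - h (p + s *\<^sub>R v + 0 *\<^sub>R w)" for s
  have "\<exists>z>0. z < t \<and> F t - F 0 = (t - 0) * (D_at h (p + z *\<^sub>R v + t *\<^sub>R w) v - D_at h (p + z *\<^sub>R v + 0 *\<^sub>R w) v)"
    unfolding F_def by (rule MVT2[OF \<open>0 < t\<close>]) (use \<open>0 < t\<close> in \<open>intro DERIV_diff c1; simp\<close>)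
  then obtain z where z: "0 < z" "z < t" "F t - F 0 = t * (D_at h (p + z *\<^sub>R v + t *\<^sub>R w) v - D_at h (p + z *\<^sub>R v + 0 *\<^sub>R w) v)"
    by auto
  have "\<exists>y>0. y < t \<and> D_at h (p + z *\<^sub>R v + t *\<^sub>R w) v - D_at h (p + z *\<^sub>R v + 0 *\<^sub>R w) v = (t - 0) * D_at (\<lambda>x. D_at h x v) (p + z *\<^sub>R v + y *\<^sub>R w) w"
    by (rule MVT2[OF \<open>0 < t\<close>]) (use z in \<open>intro c2; simp\<close>)
  then obtain y where y: "0 < y" "y < t" "D_at h (p + z *\<^sub>R v + t *\<^sub>R w) v - D_at h (p + z *\<^sub>R v + 0 *\<^sub>R w) v = t * D_at (\<lambda>x. D_at h x v) (p + z *\<^sub>R v + y *\<^sub>R w) w"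
    by auto
  have "F t - F 0 = t * t * D_at (\<lambda>x. D_at h x v) (p + z *\<^sub>R v + y *\<^sub>R w) w" using z y by simp
  then show ?thesis using z y unfolding F_def
    by (intro exI[of _ z] exI[of _ y]) (simp add: algebra_simps)
qed

lemma second_derivative_symmetric:
  fixes h :: "'a::real_normed_vector \<Rightarrow> real"
  assumes "open U" "p \<in> U" "Ck_on 2 U h"
  shows "D_at (\<lambda>x. D_at h x v) p w = D_at (\<lambda>x. D_at h x w) p v"
proof (rule ccontr)
  define A where "A x = D_at (\<lambda>x. D_at h x v) x w" for x
  define B where "B x = D_at (\<lambda>x. D_at h x w) x v" for x
  assume "\<not> ?thesis"
  then have ne: "0 < \<bar>A p - B p\<bar> / 2" by (simp add: A_def B_def)
  have "continuous_on U A" "continuous_on U B"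
    using assms(3) by (auto simp: numeral_2_eq_2 A_def B_def)
  then have "isCont A p" "isCont B p" using assms by (auto simp: continuous_on_eq_continuous_at)
  then obtain d1 d2 where d1: "0 < d1" "\<And>x. dist x p < d1 \<Longrightarrow> dist (A x) (A p) < \<bar>A p - B p\<bar> / 2"
    and d2: "0 < d2" "\<And>x. dist x p < d2 \<Longrightarrow> dist (B x) (B p) < \<bar>A p - B p\<bar> / 2"
    using ne unfolding continuous_at_eps_delta by metis
  obtain e where e: "0 < e" "ball p e \<subseteq> U" using assms openE by blast
  define m where "m = min e (min d1 d2)"
  define t where "t = m / (2 * (norm v + norm w + 1))"
  have m: "0 < m" using d1 d2 e by (simp add: m_def)
  have t: "0 < t" using m by (auto simp: t_def intro!: divide_pos_pos add_nonneg_pos)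
  have near: "dist (p + s *\<^sub>R v + r *\<^sub>R w) p < m" if "\<bar>s\<bar> \<le> t" "\<bar>r\<bar> \<le> t" for s r
  proof -
    have "dist (p + s *\<^sub>R v + r *\<^sub>R w) p = norm (s *\<^sub>R v + r *\<^sub>R w)" by (simp add: dist_norm algebra_simps)
    also have "\<dots> \<le> \<bar>s\<bar> * norm v + \<bar>r\<bar> * norm w" by (metis norm_scaleR norm_triangle_ineq)
    also have "\<dots> \<le> t * norm v + t * norm w" using that by (intro add_mono mult_right_mono) auto
    also have "\<dots> < t * (2 * (norm v + norm w + 1))" using t
      by (simp add: algebra_simps add_nonneg_pos add_pos_nonneg add_strict_increasing2)
    also have "\<dots> = m"
    proof -
      have "norm v + norm w + 1 \<noteq> 0" by (smt (verit) norm_ge_zero)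
      then show ?thesis by (simp add: t_def)
    qed
    finally show ?thesis .
  qed
  have inU: "p + s *\<^sub>R v + r *\<^sub>R w \<in> U" if "\<bar>s\<bar> \<le> t" "\<bar>r\<bar> \<le> t" for s r
    using near[OF that] e by (auto simp: m_def dist_commute subset_iff)
  have inU': "p + s *\<^sub>R w + r *\<^sub>R v \<in> U" if "\<bar>s\<bar> \<le> t" "\<bar>r\<bar> \<le> t" for s r
    using inU[OF that(2,1)] by (simp add: add_ac)
  obtain s r where 1: "\<bar>s\<bar> \<le> t" "\<bar>r\<bar> \<le> t" 
    "h (p + t *\<^sub>R v + t *\<^sub>R w) - h (p + t *\<^sub>R v) - h (p + t *\<^sub>R w) + h p = t * t * A (p + s *\<^sub>R v + r *\<^sub>R w)"
    using second_difference[OF t inU assms(3)] unfolding A_def by blast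
  obtain s' r' where 2: "\<bar>s'\<bar> \<le> t" "\<bar>r'\<bar> \<le> t" 
    "h (p + t *\<^sub>R w + t *\<^sub>R v) - h (p + t *\<^sub>R w) - h (p + t *\<^sub>R v) + h p = t * t * B (p + s' *\<^sub>R w + r' *\<^sub>R v)"
    using second_difference[OF t inU' assms(3)] unfolding B_def by blast
  have "t * t * A (p + s *\<^sub>R v + r *\<^sub>R w) = t * t * B (p + r' *\<^sub>R v + s' *\<^sub>R w)"
  proof -
    have "h (p + t *\<^sub>R w + t *\<^sub>R v) = h (p + t *\<^sub>R v + t *\<^sub>R w)"
      "B (p + s' *\<^sub>R w + r' *\<^sub>R v) = B (p + r' *\<^sub>R v + s' *\<^sub>R w)"
      by (simp_all add: add_ac)
    note c = this
    have "t * t * A (p + s *\<^sub>R v + r *\<^sub>R w)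
        = h (p + t *\<^sub>R w + t *\<^sub>R v) - h (p + t *\<^sub>R w) - h (p + t *\<^sub>R v) + h p"
      unfolding 1(3)[symmetric] c(1) by (simp only: diff_right_commute)
    then show ?thesis unfolding 2(3) c(2) .
  qed
  then have eq: "A (p + s *\<^sub>R v + r *\<^sub>R w) = B (p + r' *\<^sub>R v + s' *\<^sub>R w)" using t by simp
  have key: False if "\<bar>c - a\<bar> < \<bar>a - b\<bar> / 2" "\<bar>c - b\<bar> < \<bar>a - b\<bar> / 2" for a b c :: real
    using that by (auto simp: abs_if split: if_splits)
  show False
    using key[of "B (p + r' *\<^sub>R v + s' *\<^sub>R w)" "A p" "B p"] d1(2)[of "p + s *\<^sub>R v + r *\<^sub>R w"] near[OF 1(1,2)] d2(2)[of "p + r' *\<^sub>R v + s' *\<^sub>R w"] near[OF 2(2,1)] eq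
    by (auto simp: m_def dist_real_def)
qed


lemma linear_axis_expand:
  fixes v :: "real ^ 'n"
  assumes "linear f" shows "f v = (\<Sum>k\<in>UNIV. v $ k *\<^sub>R f (axis k 1))"
proof -
  have "f v = f (\<Sum>k\<in>UNIV. v $ k *\<^sub>R axis k 1)"
    using basis_expansion[of v] by (simp add: scalar_mult_eq_scaleR)
  then show ?thesis using assms by (simp add: linear_sum linear_cmul)
qed

lemma bounded_linear_base_point: "bounded_linear base_point"
  by (auto simp: linear_conv_bounded_linear[symmetric] base_point_def vec_eq_iff intro!: linearI)

lemma bounded_linear_fibre_vector: "bounded_linear fibre_vector"
  by (auto simp: linear_conv_bounded_linear[symmetric] fibre_vector_def vec_eq_iff intro!: linearI)

lemma tangent_bundle_vimage: "tangent_bundle U = base_point -` U"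
  by (auto simp: tangent_bundle_def)

lemma open_tangent_bundle: "open U \<Longrightarrow> open (tangent_bundle U)"
  unfolding tangent_bundle_vimage
  by (intro open_vimage linear_continuous_on bounded_linear_base_point)

lemma Ck_on_vecI:
  fixes F :: "'a::real_normed_vector \<Rightarrow> 'b::euclidean_space ^ 'n"
  assumes "open S" "\<And>i. Ck_on k S (\<lambda>x. F x $ i)" shows "Ck_on k S F"
proof -
  have "bounded_linear (\<lambda>y. axis i y :: 'b ^ 'n)" for i
    by (auto simp: linear_conv_bounded_linear[symmetric] axis_def vec_eq_iff intro!: linearI)
  then have "Ck_on k S (\<lambda>x. \<Sum>i\<in>UNIV. axis i (F x $ i) :: 'b ^ 'n)"
    by (intro Ck_on_sum assms(1)) (rule Ck_on_linear[OF _ assms])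
  moreover have "(\<Sum>i\<in>UNIV. axis i (F x $ i)) = F x" for x
    by (simp add: vec_eq_iff axis_def sum.delta)
  ultimately show ?thesis by simp
qed

lemma smooth_on_nth: "open S \<Longrightarrow> smooth_on S F \<Longrightarrow> smooth_on S (\<lambda>x. F x $ i)"
  unfolding smooth_on_def by (intro allI Ck_on_linear[OF bounded_linear_vec_nth]) auto

lemma smooth_on_D: "smooth_on S F \<Longrightarrow> smooth_on S (\<lambda>x. D_at F x v)"
  unfolding smooth_on_def using Ck_on.simps(2) by blast

lemma smooth_on_differentiable: "smooth_on S F \<Longrightarrow> x \<in> S \<Longrightarrow> F differentiable at x"
  unfolding smooth_on_def using Ck_on.simps(2) by blast

lemma smooth_on_linear: "bounded_linear F \<Longrightarrow> smooth_on S F"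
  unfolding smooth_on_def by (simp add: Ck_on_ident_linear)

lemma smooth_on_mult:
  fixes F G :: "'a::real_normed_vector \<Rightarrow> real"
  shows "open S \<Longrightarrow> smooth_on S F \<Longrightarrow> smooth_on S G \<Longrightarrow> smooth_on S (\<lambda>x. F x * G x)"
  unfolding smooth_on_def by (simp add: Ck_on_bilinear[OF bounded_bilinear_mult])

lemma smooth_on_sum: "open S \<Longrightarrow> (\<And>i. i \<in> I \<Longrightarrow> smooth_on S (F i)) \<Longrightarrow> smooth_on S (\<lambda>x. \<Sum>i\<in>I. F i x)"
  unfolding smooth_on_def by (simp add: Ck_on_sum)

lemma smooth_on_vecI:
  fixes F :: "'a::real_normed_vector \<Rightarrow> 'b::euclidean_space ^ 'n"
  shows "open S \<Longrightarrow> (\<And>i. smooth_on S (\<lambda>x. F x $ i)) \<Longrightarrow> smooth_on S F"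
  unfolding smooth_on_def by (simp add: Ck_on_vecI)

lemma smooth_on_cong: "open S \<Longrightarrow> smooth_on S F \<Longrightarrow> (\<And>x. x \<in> S \<Longrightarrow> F x = G x) \<Longrightarrow> smooth_on S G"
  unfolding smooth_on_def using Ck_on_cong by metis

lemma smooth_on_base_point: "open U \<Longrightarrow> smooth_on U F \<Longrightarrow> smooth_on (tangent_bundle U) (\<lambda>w. F (base_point w))"
  unfolding smooth_on_def tangent_bundle_vimage by (simp add: Ck_on_compose_linear bounded_linear_base_point)

lemma complete_lift_fun_eq:
  fixes h :: "real ^ 'n \<Rightarrow> real"
  assumes "h differentiable at (base_point w)"
  shows "complete_lift_fun h w = (\<Sum>k\<in>UNIV. w $ Inr k * D_at h (base_point w) (axis k 1))"
  using linear_axis_expand[OF linear_frechet_derivative[OF assms], of "fibre_vector w"]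
  by (simp add: complete_lift_fun_def iota_def fibre_vector_def)

lemma smooth_on_complete_lift_fun:
  assumes U: "open U" and h: "smooth_on U h"
  shows "smooth_on (tangent_bundle U) (complete_lift_fun h)"
proof (rule smooth_on_cong[OF open_tangent_bundle[OF U]])
  show "smooth_on (tangent_bundle U) (\<lambda>w. \<Sum>k\<in>UNIV. w $ Inr k * D_at h (base_point w) (axis k 1))"
    using open_tangent_bundle[OF U] 
    by (intro smooth_on_sum smooth_on_mult smooth_on_linear bounded_linear_vec_nth
        smooth_on_base_point[where F="\<lambda>x. D_at h x (axis _ 1)"] smooth_on_D h U)
qed (use h in \<open>auto simp: complete_lift_fun_eq tangent_bundle_def smooth_on_differentiable\<close>)

lemma complete_lift_fun_derivative:
  assumes U: "open U" and h: "smooth_on U h" and w: "w \<in> tangent_bundle U"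
  shows "D_at (complete_lift_fun h) w V = D_at h (base_point w) (fibre_vector V)
      + (\<Sum>k\<in>UNIV. w $ Inr k * D_at (\<lambda>x. D_at h x (axis k 1)) (base_point w) (base_point V))"
proof -
  let ?p = "base_point w"
  have p: "?p \<in> U" using w by (simp add: tangent_bundle_def)
  have 1: "((\<lambda>w. D_at h (base_point w) (axis k 1)) has_derivative
      (\<lambda>V. D_at (\<lambda>x. D_at h x (axis k 1)) ?p (base_point V))) (at w)" for k
    using diff_chain_at[OF bounded_linear_imp_has_derivative[OF bounded_linear_base_point]
        D_works[OF smooth_on_differentiable[OF smooth_on_D[OF h] p]], of "axis k 1"] by (simp add: o_def)
  have 2: "((\<lambda>w. w $ Inr k) has_derivative (\<lambda>V. V $ Inr k)) (at w)" for k
    by (simp add: bounded_linear_imp_has_derivative bounded_linear_vec_nth)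
  have "((\<lambda>w. \<Sum>k\<in>UNIV. w $ Inr k * D_at h (base_point w) (axis k 1)) has_derivative
      (\<lambda>V. \<Sum>k\<in>UNIV. w $ Inr k * D_at (\<lambda>x. D_at h x (axis k 1)) ?p (base_point V) + V $ Inr k * D_at h ?p (axis k 1))) (at w)"
    by (intro has_derivative_sum has_derivative_mult 1 2)
  then have "(complete_lift_fun h has_derivative
      (\<lambda>V. \<Sum>k\<in>UNIV. w $ Inr k * D_at (\<lambda>x. D_at h x (axis k 1)) ?p (base_point V) + V $ Inr k * D_at h ?p (axis k 1))) (at w)"
    by (rule has_derivative_transform_within_open[OF _ open_tangent_bundle[OF U] w])
      (use h in \<open>auto simp: complete_lift_fun_eq tangent_bundle_def smooth_on_differentiable\<close>)
  from D_eq[OF this] show ?thesis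
    using linear_axis_expand[OF linear_frechet_derivative[OF smooth_on_differentiable[OF h p]], of "fibre_vector V"]
    by (simp add: sum.distrib fibre_vector_def)
qed

lemma complete_lift_vf_apply:
  fixes Z :: "real ^ 'n \<Rightarrow> real ^ 'n"
  assumes U: "open U" and h: "smooth_on U h" and Z: "smooth_on U Z" and w: "w \<in> tangent_bundle U"
  shows "complete_lift_fun (vf_apply Z h) w
     = (\<Sum>i\<in>UNIV. Z (base_point w) $ i * D_at (\<lambda>x. D_at h x (axis i 1)) (base_point w) (fibre_vector w))
     + D_at h (base_point w) (\<chi> i. complete_lift_fun (\<lambda>x. Z x $ i) w)"
proof -
  let ?p = "base_point w"
  have p: "?p \<in> U" using w by (simp add: tangent_bundle_def)
  have ex: "D_at h x y = (\<Sum>i\<in>UNIV. y $ i * D_at h x (axis i 1))" if "x \<in> U" for x y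
    using linear_axis_expand[OF linear_frechet_derivative[OF smooth_on_differentiable[OF h that]], of y] by simp
  have "((\<lambda>x. \<Sum>i\<in>UNIV. Z x $ i * D_at h x (axis i 1)) has_derivative
      (\<lambda>v. \<Sum>i\<in>UNIV. Z ?p $ i * D_at (\<lambda>x. D_at h x (axis i 1)) ?p v + D_at (\<lambda>x. Z x $ i) ?p v * D_at h ?p (axis i 1))) (at ?p)"
    by (intro has_derivative_sum has_derivative_mult D_works smooth_on_differentiable[OF _ p] smooth_on_D h smooth_on_nth U Z)
  then have "(vf_apply Z h has_derivative
      (\<lambda>v. \<Sum>i\<in>UNIV. Z ?p $ i * D_at (\<lambda>x. D_at h x (axis i 1)) ?p v + D_at (\<lambda>x. Z x $ i) ?p v * D_at h ?p (axis i 1))) (at ?p)"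
    by (rule has_derivative_transform_within_open[OF _ U p]) (auto simp: vf_apply_def ex[symmetric])
  from D_eq[OF this] show ?thesis
    by (subst ex[OF p]) (simp add: complete_lift_fun_def iota_def sum.distrib)
qed

definition lift_field_coords :: "(real ^ 'n \<Rightarrow> real ^ 'n) \<Rightarrow> real ^ ('n + 'n) \<Rightarrow> real ^ ('n + 'n)" where
  "lift_field_coords Z w =
     (\<chi> a. case a of Inl i \<Rightarrow> Z (base_point w) $ i | Inr i \<Rightarrow> complete_lift_fun (\<lambda>x. Z x $ i) w)"

lemma lift_field_coords_simps [simp]:
  "base_point (lift_field_coords Z w) = Z (base_point w)"
  "fibre_vector (lift_field_coords Z w) = (\<chi> i. complete_lift_fun (\<lambda>x. Z x $ i) w)"
  "lift_field_coords Z w $ Inl i = Z (base_point w) $ i"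
  "lift_field_coords Z w $ Inr i = complete_lift_fun (\<lambda>x. Z x $ i) w"
  by (auto simp: lift_field_coords_def base_point_def fibre_vector_def)

lemma is_complete_lift_field_coords:
  fixes Z :: "real ^ 'n \<Rightarrow> real ^ 'n"
  assumes U: "open U" and Z: "smooth_on U Z"
  shows "is_complete_lift_field U Z (lift_field_coords Z)"
  unfolding is_complete_lift_field_def
proof (intro conjI allI impI ballI)
  show "smooth_on (tangent_bundle U) (lift_field_coords Z)"
  proof (rule smooth_on_vecI[OF open_tangent_bundle[OF U]])
    fix a :: "'n + 'n"
    show "smooth_on (tangent_bundle U) (\<lambda>w. lift_field_coords Z w $ a)"
    proof (cases a)
      case (Inl i)
      then show ?thesis using smooth_on_base_point[OF U smooth_on_nth[OF U Z]] by simp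
    next
      case (Inr i)
      then show ?thesis using smooth_on_complete_lift_fun[OF U smooth_on_nth[OF U Z]] by simp
    qed
  qed
next
  fix h :: "real ^ 'n \<Rightarrow> real" and w :: "real ^ ('n + 'n)"
  assume h: "smooth_on U h" and w: "w \<in> tangent_bundle U"
  let ?p = "base_point w"
  have p: "?p \<in> U" using w by (simp add: tangent_bundle_def)
  have sym: "D_at (\<lambda>x. D_at h x v) ?p u = D_at (\<lambda>x. D_at h x u) ?p v" for u v
    using second_derivative_symmetric[OF U p] h unfolding smooth_on_def by blast
  have lin: "linear (D_at (\<lambda>x. D_at h x v) ?p)" for v
    by (intro linear_frechet_derivative smooth_on_differentiable[OF _ p] smooth_on_D h)
  have sw: "(\<Sum>k\<in>UNIV. u $ k * D_at (\<lambda>x. D_at h x (axis k 1)) ?p v) = D_at (\<lambda>x. D_at h x v) ?p u" for u v :: "real ^ 'n"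
    using linear_axis_expand[OF lin, of v u] by (simp add: sym[of "axis _ 1" v])
  have "(\<Sum>k\<in>UNIV. w $ Inr k * D_at (\<lambda>x. D_at h x (axis k 1)) ?p (Z ?p))
      = (\<Sum>i\<in>UNIV. Z ?p $ i * D_at (\<lambda>x. D_at h x (axis i 1)) ?p (fibre_vector w))"
    using sw[of "fibre_vector w" "Z ?p"] sw[of "Z ?p" "fibre_vector w"] sym[of "Z ?p" "fibre_vector w"]
    by (simp add: fibre_vector_def)
  then show "vf_apply (lift_field_coords Z) (complete_lift_fun h) w = complete_lift_fun (vf_apply Z h) w"
    unfolding vf_apply_def[of "lift_field_coords Z"]
    by (simp add: complete_lift_fun_derivative[OF U h w] complete_lift_vf_apply[OF U h Z w])
qed

lemma is_complete_lift_field_unique: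
  fixes Z :: "real ^ 'n \<Rightarrow> real ^ 'n"
  assumes U: "open U" and Z: "smooth_on U Z" and ZC: "is_complete_lift_field U Z ZC"
    and w: "w \<in> tangent_bundle U"
  shows "ZC w = lift_field_coords Z w"
proof -
  have main: "D_at h (base_point w) (fibre_vector (ZC w))
      + (\<Sum>k\<in>UNIV. w $ Inr k * D_at (\<lambda>x. D_at h x (axis k 1)) (base_point w) (base_point (ZC w)))
     = (\<Sum>i\<in>UNIV. Z (base_point w) $ i * D_at (\<lambda>x. D_at h x (axis i 1)) (base_point w) (fibre_vector w))
     + D_at h (base_point w) (\<chi> i. complete_lift_fun (\<lambda>x. Z x $ i) w)"
    if w: "w \<in> tangent_bundle U" and h: "smooth_on U h" for w h
  proof -
    have "vf_apply ZC (complete_lift_fun h) w = complete_lift_fun (vf_apply Z h) w"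
      using ZC w h unfolding is_complete_lift_field_def by blast
    then show ?thesis
      unfolding vf_apply_def[of ZC] complete_lift_fun_derivative[OF U h w] complete_lift_vf_apply[OF U h Z w] .
  qed
  have Dn: "D_at (\<lambda>x::real^'n. x $ i) x = (\<lambda>v. v $ i)" for i x
    by (rule D_eq) (simp add: bounded_linear_imp_has_derivative bounded_linear_vec_nth)
  have fib: "fibre_vector (ZC w) = (\<chi> i. complete_lift_fun (\<lambda>x. Z x $ i) w)" if "w \<in> tangent_bundle U" for w
    using main[OF that smooth_on_linear[OF bounded_linear_vec_nth]] by (simp add: Dn vec_eq_iff)
  have Dq: "D_at (\<lambda>x::real^'n. x $ i * x $ j) x = (\<lambda>v. x $ i * v $ j + v $ i * x $ j)" for i j x
    by (rule D_eq) (intro has_derivative_mult bounded_linear_imp_has_derivative bounded_linear_vec_nth)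
  have Dqq: "D_at (\<lambda>x::real^'n. D_at (\<lambda>x. x $ i * x $ j) x (axis k 1)) x v
      = (if k = j then v $ i else 0) + (if k = i then v $ j else 0)" for i j k x v
  proof -
    have "((\<lambda>x::real^'n. D_at (\<lambda>x. x $ i * x $ j) x (axis k 1)) has_derivative
        (\<lambda>v. v $ i * axis k 1 $ j + axis k 1 $ i * v $ j)) (at x)"
      unfolding Dq by (intro has_derivative_add has_derivative_mult_left has_derivative_mult_right bounded_linear_imp_has_derivative bounded_linear_vec_nth)
    from D_eq[OF this] show ?thesis by (simp add: axis_def)
  qed
  have quad: "w $ Inr j * base_point (ZC w) $ i + w $ Inr i * base_point (ZC w) $ j
      = w $ Inr j * Z (base_point w) $ i + w $ Inr i * Z (base_point w) $ j"
    if "w \<in> tangent_bundle U" for w i j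
  proof -
    have s: "smooth_on U (\<lambda>x. x $ i * x $ j)"
      by (intro smooth_on_mult U smooth_on_linear bounded_linear_vec_nth)
    have e: "(\<Sum>k\<in>UNIV. c k * ((if k = j then a else 0) + (if k = i then b else 0))) = c j * a + c i * b"
      for c :: "'n \<Rightarrow> real" and a b
    proof -
      have "c k * ((if k = j then a else 0) + (if k = i then b else 0))
          = (if k = j then c j * a else 0) + (if k = i then c i * b else 0)" for k
        by (simp add: distrib_left)
      then show ?thesis by (simp add: sum.distrib)
    qed
    show ?thesis using main[OF that s] fib[OF that]
      unfolding Dqq e by (simp add: fibre_vector_def mult.commute)
  qed
  have nz: "base_point (ZC w) = Z (base_point w)" if "w \<in> tangent_bundle U" "w $ Inr j \<noteq> 0" for w j
  proof -
    have "base_point (ZC w) $ j = Z (base_point w) $ j" using quad[OF that(1), of j j] that(2) by simp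
    then show ?thesis using quad[OF that(1), of j] that(2) by (simp add: vec_eq_iff)
  qed
  have bas: "base_point (ZC w) = Z (base_point w)"
  proof (cases "\<exists>j. w $ Inr j \<noteq> 0")
    case True then show ?thesis using nz[OF w] by blast
  next
    case False
    fix j :: 'n
    define s where "s n = w + inverse (real (Suc n)) *\<^sub>R axis (Inr j) 1" for n
    have b: "base_point (s n) = base_point w" for n
      by (simp add: s_def base_point_def vec_eq_iff axis_def)
    have s: "s n \<in> tangent_bundle U" for n using w by (simp add: tangent_bundle_def b)
    have "s \<longlonglongrightarrow> w + 0 *\<^sub>R axis (Inr j) 1" unfolding s_def
      by (intro tendsto_intros LIMSEQ_inverse_real_of_nat)
    then have lim: "s \<longlonglongrightarrow> w" by simp
    have "continuous_on (tangent_bundle U) ZC"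
      using ZC unfolding is_complete_lift_field_def smooth_on_def by (metis Ck_on.simps(1))
    then have "isCont ZC w" using open_tangent_bundle[OF U] w by (simp add: continuous_on_eq_continuous_at)
    then have "isCont (\<lambda>w. base_point (ZC w)) w"
      by (rule bounded_linear.isCont[OF bounded_linear_base_point])
    from isCont_tendsto_compose[OF this lim] have "(\<lambda>n. base_point (ZC (s n))) \<longlonglongrightarrow> base_point (ZC w)" .
    moreover have "base_point (ZC (s n)) = Z (base_point w)" for n
    proof -
      have "s n $ Inr j \<noteq> 0" using False by (simp add: s_def)
      from nz[OF s this] show ?thesis by (simp add: b)
    qed
    ultimately show ?thesis by (simp add: LIMSEQ_const_iff)
  qed
  show ?thesis
  proof (subst vec_eq_iff, rule allI)
    fix a show "ZC w $ a = lift_field_coords Z w $ a"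
      using bas fib[OF w] by (cases a) (auto simp: vec_eq_iff base_point_def[of "ZC w"] fibre_vector_def[of "ZC w"])
  qed
qed

definition lift_metric_coords ::
  "(real ^ 'n \<Rightarrow> real ^ 'n ^ 'n) \<Rightarrow> real ^ ('n + 'n) \<Rightarrow> real ^ ('n + 'n) ^ ('n + 'n)" where
  "lift_metric_coords g w = (\<chi> a b.
     case a of
       Inl i \<Rightarrow> (case b of Inl j \<Rightarrow> (\<Sum>k\<in>UNIV. w $ Inr k * partial k (\<lambda>x. g x $ i $ j) (base_point w))
                       | Inr j \<Rightarrow> g (base_point w) $ i $ j)
     | Inr i \<Rightarrow> (case b of Inl j \<Rightarrow> g (base_point w) $ i $ j | Inr j \<Rightarrow> 0))"

lemma sum_UNIV_Plus:
  fixes F :: "'a::finite + 'b::finite \<Rightarrow> 'c::comm_monoid_add"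
  shows "sum F UNIV = (\<Sum>i\<in>UNIV. F (Inl i)) + (\<Sum>i\<in>UNIV. F (Inr i))"
  by (simp add: UNIV_Plus_UNIV[symmetric] sum.Plus del: UNIV_Plus_UNIV)

theorem is_complete_lift_metric_coords:
  fixes g :: "real ^ 'n \<Rightarrow> real ^ 'n ^ 'n"
  assumes U: "open U" and g: "pseudo_riemannian_on U g"
  shows "is_complete_lift_metric U g (lift_metric_coords g)"
proof -
  note T = open_tangent_bundle[OF U]
  have gs: "smooth_on U (\<lambda>x. g x $ i $ j)" for i j
    using g by (intro smooth_on_nth U) (simp add: pseudo_riemannian_on_def)
  have gsym: "g x $ i $ j = g x $ j $ i" if "x \<in> U" for x i j
    using g that by (simp add: pseudo_riemannian_on_def transpose_def vec_eq_iff)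
  have LL: "lift_metric_coords g w $ Inl i $ Inl j = complete_lift_fun (\<lambda>x. g x $ i $ j) w"
    if "w \<in> tangent_bundle U" for w i j
    using complete_lift_fun_eq[OF smooth_on_differentiable[OF gs]] that
    by (simp add: lift_metric_coords_def partial_def tangent_bundle_def)
  have R: "lift_metric_coords g w $ Inl i $ Inr j = g (base_point w) $ i $ j"
     "lift_metric_coords g w $ Inr i $ Inl j = g (base_point w) $ i $ j"
     "lift_metric_coords g w $ Inr i $ Inr j = 0" for w i j
    by (simp_all add: lift_metric_coords_def)
  have smooth: "smooth_on (tangent_bundle U) (lift_metric_coords g)"
  proof (intro smooth_on_vecI T)
    fix a b :: "'n + 'n"
    show "smooth_on (tangent_bundle U) (\<lambda>w. lift_metric_coords g w $ a $ b)"
    proof (cases a)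
      case (Inl i)
      show ?thesis
      proof (cases b)
        case j: (Inl j)
        show ?thesis unfolding Inl j
          by (rule smooth_on_cong[OF T smooth_on_complete_lift_fun[OF U gs]]) (simp add: LL)
      qed (use Inl smooth_on_base_point[OF U gs] in \<open>simp add: R\<close>)
    next
      case (Inr i)
      show ?thesis
      proof (cases b)
        case j: (Inr j)
        show ?thesis unfolding Inr j R by (simp add: smooth_on_linear)
      qed (use Inr smooth_on_base_point[OF U gs] in \<open>simp add: R\<close>)
    qed
  qed
  have sym: "transpose (lift_metric_coords g w) = lift_metric_coords g w" if w: "w \<in> tangent_bundle U" for w
  proof -
    have p: "base_point w \<in> U" using w by (simp add: tangent_bundle_def)
    have "partial k (\<lambda>x. g x $ i $ j) (base_point w) = partial k (\<lambda>x. g x $ j $ i) (base_point w)" for i j k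
      unfolding partial_def
      using frechet_derivative_transform_within_open[OF smooth_on_differentiable[OF gs p] U p, where g = "\<lambda>x. g x $ j $ i"] gsym
      by metis
    then show ?thesis using gsym[OF p]
      by (auto simp: lift_metric_coords_def transpose_def vec_eq_iff split: sum.splits)
  qed
  have inv: "invertible (lift_metric_coords g w)" if w: "w \<in> tangent_bundle U" for w
  proof -
    have p: "base_point w \<in> U" using w by (simp add: tangent_bundle_def)
    have "invertible (g (base_point w))" using g p by (simp add: pseudo_riemannian_on_def)
    then have ker: "x = 0" if "g (base_point w) *v x = 0" for x
      using that matrix_left_invertible_ker invertible_left_inverse by blast
    have "x = 0" if x: "lift_metric_coords g w *v x = 0" for x
    proof -
      have "(lift_metric_coords g w *v x) $ Inr i = (g (base_point w) *v base_point x) $ i" for i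
        by (simp add: matrix_vector_mult_def sum_UNIV_Plus R base_point_def)
      then have "g (base_point w) *v base_point x = 0" using x by (simp add: vec_eq_iff)
      then have b: "x $ Inl i = 0" for i using ker by (metis base_point_def vec_lambda_beta zero_index)
      have "(lift_metric_coords g w *v x) $ Inl i = (g (base_point w) *v fibre_vector x) $ i" for i
        by (simp add: matrix_vector_mult_def sum_UNIV_Plus R fibre_vector_def b)
      then have "g (base_point w) *v fibre_vector x = 0" using x by (simp add: vec_eq_iff)
      then have c: "x $ Inr i = 0" for i using ker by (metis fibre_vector_def vec_lambda_beta zero_index)
      show ?thesis
      proof (subst vec_eq_iff, rule allI)
        fix a show "x $ a = 0 $ a" using b c by (cases a) auto
      qed
    qed
    then show ?thesis using matrix_left_invertible_ker invertible_left_inverse by blast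
  qed
  have eq: "metric_apply (lift_metric_coords g) ZC WC w = complete_lift_fun (metric_apply g Z W) w"
    if Z: "smooth_on U Z" and W: "smooth_on U W" and ZC: "is_complete_lift_field U Z ZC"
      and WC: "is_complete_lift_field U W WC" and w: "w \<in> tangent_bundle U" for Z W ZC WC w
  proof -
    let ?p = "base_point w"
    have p: "?p \<in> U" using w by (simp add: tangent_bundle_def)
    have d: "((\<lambda>x. g x $ i $ j) has_derivative D_at (\<lambda>x. g x $ i $ j) ?p) (at ?p)"
      "((\<lambda>x. Z x $ i) has_derivative D_at (\<lambda>x. Z x $ i) ?p) (at ?p)"
      "((\<lambda>x. W x $ i) has_derivative D_at (\<lambda>x. W x $ i) ?p) (at ?p)" for i j
      by (intro D_works smooth_on_differentiable[OF _ p] gs smooth_on_nth[OF U Z] smooth_on_nth[OF U W])+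
    have "((metric_apply g Z W) has_derivative (\<lambda>v. \<Sum>i\<in>UNIV. \<Sum>j\<in>UNIV.
         g ?p $ i $ j * Z ?p $ i * D_at (\<lambda>x. W x $ j) ?p v
       + (g ?p $ i $ j * D_at (\<lambda>x. Z x $ i) ?p v + D_at (\<lambda>x. g x $ i $ j) ?p v * Z ?p $ i) * W ?p $ j)) (at ?p)"
      unfolding metric_apply_def[abs_def] by (intro has_derivative_sum has_derivative_mult d)
    from D_eq[OF this] show ?thesis
      unfolding metric_apply_def[of "lift_metric_coords g"] is_complete_lift_field_unique[OF U Z ZC w]
        is_complete_lift_field_unique[OF U W WC w]
      by (simp add: sum_UNIV_Plus R LL[OF w] sum.distrib algebra_simps complete_lift_fun_def iota_def)
  qed
  show ?thesis
    unfolding is_complete_lift_metric_def pseudo_riemannian_on_def using smooth sym inv eq by blast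
qed

end

theory Submission
  imports Defs
begin

text \<open>
  The theorem splits into a statement about complete lifts of arbitrary metrics and a computation
  on the base.

  For the first part, the identity map from \<open>g\<close> to \<open>h\<close> has the tension field
  \<open>g\<^sup>i\<^sup>j (\<Gamma>\<^sup>h - \<Gamma>\<^sup>g)\<^sup>k\<^sub>i\<^sub>j\<close>, the trace of the difference of the two connections.  On the tangent
  bundle, the inverse of the lifted metric has no components between two base directions, so the
  trace only sees the Christoffel symbols with at least one fibre index below.  Of these, the ones
  with two fibre indices vanish, and the ones with one base and one fibre index are vertical and
  repeat the Christoffel symbols of the base.  Because the mixed block of the inverse is \<open>g\<^sup>i\<^sup>j\<close> and
  occurs twice, the tension field upstairs is vertical and equals twice the one of the base
  (\<open>tension_field_lift_metric_coords\<close>).  Hence the complete lift of \<open>h\<close> is harmonic with respect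
  to that of \<open>g\<close> iff \<open>h\<close> is harmonic with respect to \<open>g\<close> (\<open>harmonic_complete_lift_iff\<close>).

  These computations use the coordinate form of the lifted metric.  An abstract complete lift has
  that form since the lifts of vector fields take every value at each nonzero tangent vector, and
  the zero section is in the closure of the nonzero vectors (\<open>is_complete_lift_metric_unique\<close>).

  For the second part, Kantowski-Sachs metrics are diagonal.  Their \<open>t\<close>- and \<open>\<theta>\<close>-components of the
  tension field are, up to sign and a nonvanishing factor, the two expressions in the theorem, and
  the other two components vanish because nothing depends on \<open>r\<close> and \<open>\<phi>\<close>
  (\<open>tension_field_gks_metric_eq_0_iff\<close>).
\<close>

section \<open>Christoffel symbols and the tension field of the identity\<close>

lemma partial_cong:
  assumes "open S" "x \<in> S" "\<And>y. y \<in> S \<Longrightarrow> F y = G y"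
  shows "partial i F x = partial i G x"
proof -
  have "(F has_derivative D) (at x) \<longleftrightarrow> (G has_derivative D) (at x)" for D
    using has_derivative_transform_within_open[OF _ assms(1,2), of F D UNIV G]
      has_derivative_transform_within_open[OF _ assms(1,2), of G D UNIV F] assms(3) by auto
  then show ?thesis
    by (simp add: partial_def frechet_derivative_def)
qed

text \<open>
  Christoffel symbols are local.  This is what allows an abstract complete lift, which is determined
  only on the tangent bundle, to be replaced by its coordinate form.
\<close>

lemma christoffel_cong:
  assumes "open S" "x \<in> S" "\<And>y. y \<in> S \<Longrightarrow> g y = h y"
  shows "christoffel g k i j x = christoffel h k i j x"
proof -
  have "partial l (\<lambda>y. g y $ a $ b) x = partial l (\<lambda>y. h y $ a $ b) x" for l a b
    by (rule partial_cong[OF assms(1,2)]) (simp add: assms(3))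
  then show ?thesis
    by (simp add: christoffel_def assms(2,3))
qed

lemma christoffel_symmetric:
  assumes "open U" "pseudo_riemannian_on U g" "x \<in> U"
  shows "christoffel g k i j x = christoffel g k j i x"
proof -
  have "g y $ i $ j = g y $ j $ i" if "y \<in> U" for y
  proof -
    have "transpose (g y) $ j $ i = g y $ j $ i"
      using assms(2) that by (simp add: pseudo_riemannian_on_def)
    then show ?thesis by (simp add: transpose_def)
  qed
  then have "partial l (\<lambda>y. g y $ i $ j) x = partial l (\<lambda>y. g y $ j $ i) x" for l
    by (rule partial_cong[OF assms(1,3)])
  then show ?thesis
    by (simp add: christoffel_def add.commute)
qed

text \<open>
  The coordinates of the identity have constant first and zero second derivatives, so only the
  difference of the two connections is left.
\<close>

lemma tension_field_identity:
  "tension_field g h (\<lambda>x. x) x $ c =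
     (\<Sum>i\<in>UNIV. \<Sum>j\<in>UNIV. matrix_inv (g x) $ i $ j * (christoffel h c i j x - christoffel g c i j x))"
proof -
  have 1: "partial j (\<lambda>y. y $ a) = (\<lambda>x. if a = j then 1 else 0)" for j a :: 'a
  proof
    fix x :: "real ^ 'a"
    have "((\<lambda>y. y $ a) has_derivative (\<lambda>v. v $ a)) (at x)"
      by (simp add: bounded_linear_imp_has_derivative bounded_linear_vec_nth)
    then show "partial j (\<lambda>y. y $ a) x = (if a = j then 1 else 0)"
      by (simp add: partial_def D_eq axis_def)
  qed
  have 2: "partial i (\<lambda>x. b) x = 0" for i and b and x :: "real ^ 'a"
    by (simp add: partial_def)
  have 3: "(\<Sum>a\<in>UNIV. \<Sum>b\<in>UNIV. F a b * (if a = i then 1 else 0) * (if b = j then 1 else 0)) = F i j"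
    for F :: "'a \<Rightarrow> 'a \<Rightarrow> real" and i j
  proof -
    have "F a b * (if a = i then 1 else 0) * (if b = j then 1 else 0)
        = (if b = j then (if a = i then F a b else 0) else 0)" for a b
      by simp
    then show ?thesis by simp
  qed
  have 4: "(\<Sum>k\<in>UNIV. F k * (if c = k then 1 else 0)) = F c" for F :: "'a \<Rightarrow> real"
  proof -
    have "F k * (if c = k then 1 else 0) = (if c = k then F k else 0)" for k by simp
    then show ?thesis by simp
  qed
  show ?thesis
    unfolding tension_field_def vec_lambda_beta 1 2 3 4 by simp
qed

lemma tension_field_identity_cong:
  assumes "open S" "x \<in> S" "\<And>y. y \<in> S \<Longrightarrow> g y = g' y" "\<And>y. y \<in> S \<Longrightarrow> h y = h' y"
  shows "tension_field g h (\<lambda>x. x) x = tension_field g' h' (\<lambda>x. x) x"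
proof -
  have "christoffel g c i j x = christoffel g' c i j x" "christoffel h c i j x = christoffel h' c i j x" for c i j
    using christoffel_cong[OF assms(1,2,3)] christoffel_cong[OF assms(1,2,4)] by simp_all
  then show ?thesis
    unfolding vec_eq_iff tension_field_identity assms(3)[OF assms(2)] by simp
qed

section \<open>Uniqueness of the complete lift of a metric\<close>

text \<open>
  The lift of \<open>Z\<close> at a tangent vector \<open>u\<close> consists of the value of \<open>Z\<close> and its derivative along
  \<open>u\<close>.  These can be prescribed independently once \<open>u\<close> is not zero, and an affine field that varies
  only along one coordinate with \<open>u\<^sup>k \<noteq> 0\<close> suffices.
\<close>

lemma lift_field_values:
  fixes V w :: "real ^ ('n::finite + 'n)"
  assumes U: "open U" and u: "w $ Inr k \<noteq> 0"
  obtains Z :: "real ^ 'n \<Rightarrow> real ^ 'n" where "smooth_on U Z" "lift_field_coords Z w = V"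
proof
  define Z :: "real ^ 'n \<Rightarrow> real ^ 'n" where
    "Z x = base_point V + ((x $ k - w $ Inl k) / w $ Inr k) *\<^sub>R fibre_vector V" for x
  have Zd: "((\<lambda>x. Z x $ i) has_derivative (\<lambda>v. v $ k / w $ Inr k * V $ Inr i)) (at x)" for i x
  proof -
    have d: "((\<lambda>x::real ^ 'n. x $ k) has_derivative (\<lambda>v. v $ k)) (at x)"
      by (simp add: bounded_linear_imp_has_derivative bounded_linear_vec_nth)
    show ?thesis
      unfolding Z_def using u
      by (auto intro!: derivative_eq_intros d simp: fibre_vector_def)
  qed
  have "smooth_on U (\<lambda>x. Z x $ i)" for i
    unfolding smooth_on_def
  proof
    fix n show "Ck_on n U (\<lambda>x. Z x $ i)"
    proof (cases n)
      case 0
      have "isCont (\<lambda>x. Z x $ i) x" for x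
        using Zd has_derivative_continuous by blast
      then show ?thesis using 0 by (simp add: continuous_at_imp_continuous_on)
    next
      case (Suc m)
      then show ?thesis using Zd by (auto simp: D_eq[OF Zd] Ck_on_const differentiable_def)
    qed
  qed
  then show "smooth_on U Z"
    by (rule smooth_on_vecI[OF U])
  show "lift_field_coords Z w = V"
  proof (subst vec_eq_iff, rule allI)
    fix a show "lift_field_coords Z w $ a = V $ a"
    proof (cases a)
      case (Inl i)
      then show ?thesis by (simp add: Z_def base_point_def)
    next
      case (Inr i)
      then show ?thesis using u by (simp add: complete_lift_fun_def iota_def D_eq[OF Zd] fibre_vector_def)
    qed
  qed
qed

lemma bilinear_form_eqI:
  fixes A B :: "real ^ 'm ^ 'm"
  assumes "\<And>V W. (\<Sum>i\<in>UNIV. \<Sum>j\<in>UNIV. A $ i $ j * V $ i * W $ j) = (\<Sum>i\<in>UNIV. \<Sum>j\<in>UNIV. B $ i $ j * V $ i * W $ j)"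
  shows "A = B"
proof -
  have entry: "(\<Sum>i\<in>UNIV. \<Sum>j\<in>UNIV. C $ i $ j * axis a 1 $ i * axis b 1 $ j) = C $ a $ b"
    for C :: "real ^ 'm ^ 'm" and a b
  proof -
    have "C $ i $ j * axis a 1 $ i * axis b 1 $ j = (if j = b then (if i = a then C $ i $ j else 0) else 0)" for i j
      by (simp add: axis_def)
    then show ?thesis by simp
  qed
  have "A $ a $ b = B $ a $ b" for a b
    using assms[of "axis a 1" "axis b 1"] unfolding entry .
  then show ?thesis
    by (simp add: vec_eq_iff)
qed

text \<open>
  Off the zero section the values on lifted vector fields determine the bilinear form; on the zero
  section there are too few such values, and the claim follows by continuity.
\<close>

lemma is_complete_lift_metric_unique:
  fixes g :: "real ^ 'n \<Rightarrow> real ^ 'n ^ 'n"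
  assumes U: "open U" and g: "pseudo_riemannian_on U g" and G: "is_complete_lift_metric U g G"
    and w: "w \<in> tangent_bundle U"
  shows "G w = lift_metric_coords g w"
proof -
  note L = is_complete_lift_metric_coords[OF U g]
  have off_zero: "G w = lift_metric_coords g w" if w: "w \<in> tangent_bundle U" and u: "w $ Inr k \<noteq> 0" for w k
  proof (rule bilinear_form_eqI)
    fix V W :: "real ^ ('n + 'n)"
    obtain Z where Z: "smooth_on U Z" "lift_field_coords Z w = V"
      using lift_field_values[OF U u] .
    obtain Z' where Z': "smooth_on U Z'" "lift_field_coords Z' w = W"
      using lift_field_values[OF U u] .
    have "metric_apply G' (lift_field_coords Z) (lift_field_coords Z') w = complete_lift_fun (metric_apply g Z Z') w"
      if "is_complete_lift_metric U g G'" for G'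
      using that[unfolded is_complete_lift_metric_def, THEN conjunct2, rule_format,
          OF Z(1) Z'(1) is_complete_lift_field_coords[OF U Z(1)] is_complete_lift_field_coords[OF U Z'(1)] w] .
    from this[OF G] this[OF L]
    show "(\<Sum>i\<in>UNIV. \<Sum>j\<in>UNIV. G w $ i $ j * V $ i * W $ j)
        = (\<Sum>i\<in>UNIV. \<Sum>j\<in>UNIV. lift_metric_coords g w $ i $ j * V $ i * W $ j)"
      unfolding metric_apply_def Z(2) Z'(2) by simp
  qed
  fix j :: 'n
  show ?thesis
  proof (cases "w $ Inr j = 0")
    case False
    then show ?thesis using off_zero[OF w] by blast
  next
    case True
    \<comment> \<open>Nonzero tangent vectors at the same base point that converge to the zero vector.\<close>
    define s where "s n = w + inverse (real (Suc n)) *\<^sub>R axis (Inr j) 1" for n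
    have b: "base_point (s n) = base_point w" for n
      by (simp add: s_def base_point_def vec_eq_iff axis_def)
    have s: "s n \<in> tangent_bundle U" for n using w by (simp add: tangent_bundle_def b)
    have "s \<longlonglongrightarrow> w + 0 *\<^sub>R axis (Inr j) 1" unfolding s_def
      by (intro tendsto_intros LIMSEQ_inverse_real_of_nat)
    then have lim: "s \<longlonglongrightarrow> w" by simp
    have cont: "isCont G' w" if "is_complete_lift_metric U g G'" for G'
    proof -
      have "continuous_on (tangent_bundle U) G'"
        using that[unfolded is_complete_lift_metric_def pseudo_riemannian_on_def smooth_on_def,
            THEN conjunct1, THEN conjunct1, rule_format, of 0] by simp
      then show ?thesis using open_tangent_bundle[OF U] w by (simp add: continuous_on_eq_continuous_at)
    qed
    have agree: "G (s n) = lift_metric_coords g (s n)" for n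
      by (rule off_zero[OF s, where k = j]) (simp add: s_def True)
    show ?thesis
    proof (rule LIMSEQ_unique)
      show "(\<lambda>n. G (s n)) \<longlonglongrightarrow> G w"
        by (rule isCont_tendsto_compose[OF cont[OF G] lim])
      show "(\<lambda>n. G (s n)) \<longlonglongrightarrow> lift_metric_coords g w"
        unfolding agree by (rule isCont_tendsto_compose[OF cont[OF L] lim])
    qed
  qed
qed

section \<open>The complete lift of a harmonic metric\<close>

lemma invertible_matrix_inv:
  fixes A :: "'a::semiring_1 ^ 'n ^ 'm"
  assumes "invertible A"
  shows "A ** matrix_inv A = mat 1" "matrix_inv A ** A = mat 1"
  using someI_ex[OF assms[unfolded invertible_def]] by (simp_all add: matrix_inv_def)

lemma matrix_inv_unique:
  fixes A B :: "real ^ 'n ^ 'n"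
  assumes "A ** B = mat 1"
  shows "matrix_inv A = B"
proof -
  have "B ** A = mat 1" using assms matrix_left_right_inverse by blast
  then have "invertible A" using assms by (auto simp: invertible_def)
  then have "matrix_inv A ** (A ** B) = B"
    by (simp add: matrix_mul_assoc invertible_matrix_inv)
  then show ?thesis by (simp add: assms)
qed

text \<open>
  The lifted metric has the block form \<open>(A, g; g, 0)\<close>, whose inverse is
  \<open>(0, g\<^sup>-\<^sup>1; g\<^sup>-\<^sup>1, - g\<^sup>-\<^sup>1 A g\<^sup>-\<^sup>1)\<close>.  In the traces below the last
  block meets only Christoffel symbols that vanish.
\<close>

lemma matrix_inv_lift_metric_coords:
  fixes g :: "real ^ 'n \<Rightarrow> real ^ 'n ^ 'n"
  assumes U: "open U" and g: "pseudo_riemannian_on U g" and w: "w \<in> tangent_bundle U"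
  shows "matrix_inv (lift_metric_coords g w) $ Inl i $ Inl j = 0"
    and "matrix_inv (lift_metric_coords g w) $ Inl i $ Inr j = matrix_inv (g (base_point w)) $ i $ j"
    and "matrix_inv (lift_metric_coords g w) $ Inr i $ Inl j = matrix_inv (g (base_point w)) $ i $ j"
proof -
  let ?g = "g (base_point w)"
  define L where "L = lift_metric_coords g w"
  define H where "H = matrix_inv L"
  have "invertible L"
    using is_complete_lift_metric_coords[OF U g] w
    by (simp add: L_def is_complete_lift_metric_def pseudo_riemannian_on_def)
  then have LH: "L ** H = mat 1" and HL: "H ** L = mat 1"
    by (simp_all add: H_def invertible_matrix_inv)
  have inv: "invertible ?g"
    using g w by (simp add: pseudo_riemannian_on_def tangent_bundle_def)
  have L: "L $ Inr a $ Inl b = ?g $ a $ b" "L $ Inl a $ Inr b = ?g $ a $ b" "L $ Inr a $ Inr b = 0" for a b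
    by (simp_all add: L_def lift_metric_coords_def)
  have LH': "(\<Sum>c\<in>UNIV. L $ a $ c * H $ c $ b) = (if a = b then 1 else 0)" for a b
    using LH by (simp add: matrix_matrix_mult_def mat_def vec_eq_iff)
  have HL': "(\<Sum>c\<in>UNIV. H $ a $ c * L $ c $ b) = (if a = b then 1 else 0)" for a b
    using HL by (simp add: matrix_matrix_mult_def mat_def vec_eq_iff)
  define P where "P = (\<chi> i j. H $ Inl i $ Inl j)"
  define Q where "Q = (\<chi> i j. H $ Inl i $ Inr j)"
  define R where "R = (\<chi> i j. H $ Inr i $ Inl j)"
  \<comment> \<open>Each block of the inverse is read off from a block of a product that avoids \<open>A\<close>.\<close>
  have "?g ** P = 0"
    using LH'[of "Inr _" "Inl _"] by (simp add: P_def matrix_matrix_mult_def vec_eq_iff sum_UNIV_Plus L)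
  then have "P = matrix_inv ?g ** 0"
    using invertible_matrix_inv(2)[OF inv] by (metis matrix_mul_assoc matrix_mul_lid)
  then have "P = 0"
    by (simp add: matrix_matrix_mult_def vec_eq_iff)
  then show "matrix_inv (lift_metric_coords g w) $ Inl i $ Inl j = 0"
    by (simp add: P_def vec_eq_iff flip: L_def H_def)
  have "?g ** Q = mat 1"
    using LH'[of "Inr _" "Inr _"] by (simp add: Q_def matrix_matrix_mult_def mat_def vec_eq_iff sum_UNIV_Plus L)
  from matrix_inv_unique[OF this]
  show "matrix_inv (lift_metric_coords g w) $ Inl i $ Inr j = matrix_inv ?g $ i $ j"
    by (simp add: Q_def flip: L_def H_def)
  have "R ** ?g = mat 1"
    using HL'[of "Inr _" "Inr _"] by (simp add: R_def matrix_matrix_mult_def mat_def vec_eq_iff sum_UNIV_Plus L)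
  then have "?g ** R = mat 1"
    using matrix_left_right_inverse by blast
  from matrix_inv_unique[OF this]
  show "matrix_inv (lift_metric_coords g w) $ Inr i $ Inl j = matrix_inv ?g $ i $ j"
    by (simp add: R_def flip: L_def H_def)
qed

lemma partial_base_point:
  fixes F :: "real ^ 'n \<Rightarrow> real"
  assumes "F differentiable at (base_point w)"
  shows "partial (Inl i) (\<lambda>w. F (base_point w)) w = partial i F (base_point w)"
    and "partial (Inr i) (\<lambda>w. F (base_point w)) w = 0"
proof -
  have "((\<lambda>w. F (base_point w)) has_derivative (\<lambda>v. D_at F (base_point w) (base_point v))) (at w)"
    using diff_chain_at[OF bounded_linear_imp_has_derivative[OF bounded_linear_base_point] D_works[OF assms]]
    by (simp add: o_def)
  note D = D_eq[OF this]
  have "base_point (axis (Inl i) 1 :: real ^ ('n + 'n)) = axis i 1"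
    by (simp add: base_point_def vec_eq_iff axis_def)
  then show "partial (Inl i) (\<lambda>w. F (base_point w)) w = partial i F (base_point w)"
    by (simp add: partial_def D)
  have "base_point (axis (Inr i) 1 :: real ^ ('n + 'n)) = 0"
    by (simp add: base_point_def vec_eq_iff axis_def)
  then show "partial (Inr i) (\<lambda>w. F (base_point w)) w = 0"
    using linear_0[OF linear_frechet_derivative[OF assms]] by (simp add: partial_def D)
qed

text \<open>
  The lift \<open>u\<^sup>k \<partial>\<^sub>k h\<close> is linear in the fibre, with coefficients \<open>\<partial>\<^sub>k h\<close>.  The base-base block of a lifted metric consists of such
  lifts, and these are the only derivatives of that block that the mixed Christoffel symbols contain.
\<close>

lemma partial_fibre_complete_lift_fun:
  fixes h :: "real ^ 'n \<Rightarrow> real"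
  assumes U: "open U" and h: "smooth_on U h" and w: "w \<in> tangent_bundle U"
  shows "partial (Inr k) (complete_lift_fun h) w = partial k h (base_point w)"
proof -
  have p: "base_point w \<in> U" using w by (simp add: tangent_bundle_def)
  have lin: "linear (D_at (\<lambda>x. D_at h x v) (base_point w))" for v
    by (intro linear_frechet_derivative smooth_on_differentiable[OF _ p] smooth_on_D h)
  have ax: "base_point (axis (Inr k) 1 :: real ^ ('n + 'n)) = 0"
    "fibre_vector (axis (Inr k) 1 :: real ^ ('n + 'n)) = axis k 1"
    by (simp_all add: base_point_def fibre_vector_def vec_eq_iff axis_def)
  show ?thesis
    by (simp add: partial_def complete_lift_fun_derivative[OF U h w] ax linear_0[OF lin])
qed

text \<open>
  With \<open>i\<close> a base and \<open>j\<close> a fibre index, the bracket in the definition of the Christoffel symbol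
  vanishes for a fibre index \<open>l\<close> and is that of the base metric for a base index \<open>l\<close>.  It is then
  contracted with the inverse metric, whose base-base block is zero and whose fibre-base block is
  \<open>g\<^sup>k\<^sup>l\<close>.  With two fibre indices every term of the bracket vanishes.
\<close>

lemma christoffel_lift_metric_coords:
  fixes g :: "real ^ 'n \<Rightarrow> real ^ 'n ^ 'n"
  assumes U: "open U" and g: "pseudo_riemannian_on U g" and w: "w \<in> tangent_bundle U"
  shows "christoffel (lift_metric_coords g) (Inl k) (Inl i) (Inr j) w = 0"
    and "christoffel (lift_metric_coords g) (Inr k) (Inl i) (Inr j) w = christoffel g k i j (base_point w)"
    and "christoffel (lift_metric_coords g) c (Inr i) (Inr j) w = 0"
proof -
  let ?L = "lift_metric_coords g" and ?p = "base_point w"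
  have p: "?p \<in> U" using w by (simp add: tangent_bundle_def)
  have gs: "smooth_on U (\<lambda>x. g x $ a $ b)" for a b
    using g by (intro smooth_on_nth U) (simp add: pseudo_riemannian_on_def)
  note gd = smooth_on_differentiable[OF gs p]
  have mixed: "partial (Inl l) (\<lambda>w. ?L w $ Inl a $ Inr b) w = partial l (\<lambda>x. g x $ a $ b) ?p"
      "partial (Inl l) (\<lambda>w. ?L w $ Inr a $ Inl b) w = partial l (\<lambda>x. g x $ a $ b) ?p"
      "partial (Inr l) (\<lambda>w. ?L w $ Inl a $ Inr b) w = 0"
      "partial (Inr l) (\<lambda>w. ?L w $ Inr a $ Inl b) w = 0"
    for l a b
    using partial_base_point[OF gd[of a b], of l] by (simp_all add: lift_metric_coords_def)
  have fibre: "partial l (\<lambda>w. ?L w $ Inr a $ Inr b) w = 0" for l a b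
    by (simp add: lift_metric_coords_def partial_def)
  have base: "partial (Inr l) (\<lambda>w. ?L w $ Inl a $ Inl b) w = partial l (\<lambda>x. g x $ a $ b) ?p" for l a b
  proof -
    have "?L v $ Inl a $ Inl b = complete_lift_fun (\<lambda>x. g x $ a $ b) v" if "v \<in> tangent_bundle U" for v
      using complete_lift_fun_eq[OF smooth_on_differentiable[OF gs]] that
      by (simp add: lift_metric_coords_def partial_def tangent_bundle_def)
    then have "partial (Inr l) (\<lambda>w. ?L w $ Inl a $ Inl b) w
        = partial (Inr l) (complete_lift_fun (\<lambda>x. g x $ a $ b)) w"
      by (rule partial_cong[OF open_tangent_bundle[OF U] w])
    then show ?thesis
      by (simp add: partial_fibre_complete_lift_fun[OF U gs w])
  qed
  note simps = christoffel_def sum_UNIV_Plus mixed fibre base matrix_inv_lift_metric_coords[OF U g w]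
  show "christoffel ?L (Inl k) (Inl i) (Inr j) w = 0"
    by (simp add: simps)
  show "christoffel ?L (Inr k) (Inl i) (Inr j) w = christoffel g k i j ?p"
    by (simp add: simps)
  show "christoffel ?L c (Inr i) (Inr j) w = 0"
    by (simp add: simps)
qed

text \<open>
  The factor 2 stems from the two mixed blocks of the inverse metric, which contribute equally since
  Christoffel symbols are symmetric in the lower indices.
\<close>

lemma tension_field_lift_metric_coords:
  fixes g h :: "real ^ 'n \<Rightarrow> real ^ 'n ^ 'n"
  assumes U: "open U" and g: "pseudo_riemannian_on U g" and h: "pseudo_riemannian_on U h"
    and w: "w \<in> tangent_bundle U"
  shows "tension_field (lift_metric_coords g) (lift_metric_coords h) (\<lambda>w. w) w $ Inl k = 0"
    and "tension_field (lift_metric_coords g) (lift_metric_coords h) (\<lambda>w. w) w $ Inr k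
           = 2 * tension_field g h (\<lambda>x. x) (base_point w) $ k"
proof -
  let ?T = "tangent_bundle U"
  have sym: "christoffel (lift_metric_coords g) c (Inr i) (Inl j) w = christoffel (lift_metric_coords g) c (Inl j) (Inr i) w"
    if "pseudo_riemannian_on U g" for g :: "real ^ 'n \<Rightarrow> real ^ 'n ^ 'n" and c i j
  proof (rule christoffel_symmetric[OF open_tangent_bundle[OF U] _ w])
    show "pseudo_riemannian_on ?T (lift_metric_coords g)"
      using is_complete_lift_metric_coords[OF U that] by (simp add: is_complete_lift_metric_def)
  qed
  have csym: "christoffel g c i j (base_point w) = christoffel g c j i (base_point w)"
    if "pseudo_riemannian_on U g" for g :: "real ^ 'n \<Rightarrow> real ^ 'n ^ 'n" and c i j
    using christoffel_symmetric[OF U that] w by (simp add: tangent_bundle_def)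
  note simps = tension_field_identity sum_UNIV_Plus matrix_inv_lift_metric_coords[OF U g w]
    sym[OF g] sym[OF h] christoffel_lift_metric_coords[OF U g w] christoffel_lift_metric_coords[OF U h w]
  show "tension_field (lift_metric_coords g) (lift_metric_coords h) (\<lambda>w. w) w $ Inl k = 0"
    by (simp add: simps)
  show "tension_field (lift_metric_coords g) (lift_metric_coords h) (\<lambda>w. w) w $ Inr k
      = 2 * tension_field g h (\<lambda>x. x) (base_point w) $ k"
    using csym[OF g, of k] csym[OF h, of k] by (simp add: simps)
qed

theorem harmonic_complete_lift_iff:
  fixes g h :: "real ^ 'n \<Rightarrow> real ^ 'n ^ 'n"
  assumes U: "open U" and g: "pseudo_riemannian_on U g" and h: "pseudo_riemannian_on U h"
    and G: "is_complete_lift_metric U g G" and H: "is_complete_lift_metric U h H"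
  shows "harmonic_metric_on (tangent_bundle U) G H \<longleftrightarrow> harmonic_metric_on U g h"
proof -
  have "tension_field G H (\<lambda>w. w) w = 0 \<longleftrightarrow> tension_field g h (\<lambda>x. x) (base_point w) = 0"
    if w: "w \<in> tangent_bundle U" for w
  proof -
    have "tension_field G H (\<lambda>w. w) w = tension_field (lift_metric_coords g) (lift_metric_coords h) (\<lambda>w. w) w"
      by (intro tension_field_identity_cong[OF open_tangent_bundle[OF U] w]
          is_complete_lift_metric_unique[OF U g G] is_complete_lift_metric_unique[OF U h H])
    moreover have "v = 0 \<longleftrightarrow> (\<forall>k. v $ Inl k = 0) \<and> (\<forall>k. v $ Inr k = 0)" for v :: "real ^ ('n + 'n)"
      unfolding vec_eq_iff by (metis sum.exhaust zero_index)
    ultimately show ?thesis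
      by (simp add: tension_field_lift_metric_coords[OF U g h w] vec_eq_iff)
  qed
  moreover have "(\<forall>w\<in>tangent_bundle U. Q (base_point w)) \<longleftrightarrow> (\<forall>x\<in>U. Q x)" for Q :: "real ^ 'n \<Rightarrow> bool"
  proof -
    have "\<exists>w. base_point w = x" for x :: "real ^ 'n"
      by (rule exI[of _ "\<chi> a. case a of Inl i \<Rightarrow> x $ i | Inr i \<Rightarrow> 0"]) (simp add: base_point_def vec_eq_iff)
    then show ?thesis
      by (metis tangent_bundle_def mem_Collect_eq)
  qed
  ultimately show ?thesis
    by (simp add: harmonic_metric_on_def harmonic_map_on_def)
qed

section \<open>Diagonal metrics and generalized Kantowski-Sachs metrics\<close>

lemma matrix_inv_diagonal:
  fixes A :: "real ^ 'n ^ 'n"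
  assumes "invertible A" and "\<And>i j. i \<noteq> j \<Longrightarrow> A $ i $ j = 0"
  shows "A $ i $ i \<noteq> 0" and "matrix_inv A $ i $ j = (if i = j then 1 / A $ i $ i else 0)"
proof -
  have prod: "A $ i $ i * matrix_inv A $ i $ j = (if i = j then 1 else 0)" for j
  proof -
    have "(\<Sum>k\<in>UNIV. A $ i $ k * matrix_inv A $ k $ j) = (\<Sum>k\<in>UNIV. if k = i then A $ i $ i * matrix_inv A $ i $ j else 0)"
      by (intro sum.cong) (auto simp: assms(2))
    moreover have "(A ** matrix_inv A) $ i $ j = (if i = j then 1 else 0)"
      by (simp add: invertible_matrix_inv(1)[OF assms(1)] mat_def)
    ultimately show ?thesis
      by (simp add: matrix_matrix_mult_def)
  qed
  from prod[of i] show nz: "A $ i $ i \<noteq> 0" by auto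
  from prod[of j] nz show "matrix_inv A $ i $ j = (if i = j then 1 / A $ i $ i else 0)"
    by (auto simp: field_simps split: if_splits)
qed

lemma christoffel_diagonal:
  fixes g :: "real ^ 'n \<Rightarrow> real ^ 'n ^ 'n"
  assumes inv: "invertible (g x)" and diag: "\<And>y i j. i \<noteq> j \<Longrightarrow> g y $ i $ j = 0"
  shows "christoffel g k i i x =
    (if i = k then partial k (\<lambda>y. g y $ k $ k) x else - partial k (\<lambda>y. g y $ i $ i) x) / (2 * g x $ k $ k)"
proof -
  have off: "partial l (\<lambda>y. g y $ a $ b) x = 0" if "a \<noteq> b" for l a b
    by (simp add: diag[OF that] partial_def)
  have "christoffel g k i i x = (1/2) * (\<Sum>l\<in>UNIV. if l = k then (1 / g x $ k $ k) *
      (partial i (\<lambda>y. g y $ i $ k) x + partial i (\<lambda>y. g y $ i $ k) x - partial k (\<lambda>y. g y $ i $ i) x) else 0)"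
    unfolding christoffel_def
    by (intro arg_cong[where f = "\<lambda>s. (1/2) * s"] sum.cong refl)
      (simp add: matrix_inv_diagonal(2)[OF inv diag])
  also have "\<dots> = (partial i (\<lambda>y. g y $ i $ k) x + partial i (\<lambda>y. g y $ i $ k) x - partial k (\<lambda>y. g y $ i $ i) x)
      / (2 * g x $ k $ k)"
    by simp
  finally show ?thesis
    by (simp add: off)
qed

lemma tension_field_identity_diagonal:
  fixes g h :: "real ^ 'n \<Rightarrow> real ^ 'n ^ 'n"
  assumes inv: "invertible (g x)" and diag: "\<And>i j. i \<noteq> j \<Longrightarrow> g x $ i $ j = 0"
  shows "tension_field g h (\<lambda>x. x) x $ c =
    (\<Sum>i\<in>UNIV. (christoffel h c i i x - christoffel g c i i x) / g x $ i $ i)"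
proof -
  have "(\<Sum>j\<in>UNIV. matrix_inv (g x) $ i $ j * F j) = F i / g x $ i $ i" for i and F :: "'n \<Rightarrow> real"
  proof -
    have "(\<Sum>j\<in>UNIV. matrix_inv (g x) $ i $ j * F j) = (\<Sum>j\<in>UNIV. if j = i then F i / g x $ i $ i else 0)"
      by (intro sum.cong) (auto simp: matrix_inv_diagonal(2)[OF inv diag])
    then show ?thesis by simp
  qed
  then show ?thesis
    by (simp add: tension_field_identity)
qed

lemma gks_metric_entries:
  "i \<noteq> j \<Longrightarrow> gks_metric X Y f x $ i $ j = 0"
  "gks_metric X Y f x $ 1 $ 1 = 1"
  "gks_metric X Y f x $ 2 $ 2 = - (X (x $ 1))\<^sup>2"
  "gks_metric X Y f x $ 3 $ 3 = - (Y (x $ 1))\<^sup>2"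
  "gks_metric X Y f x $ 4 $ 4 = - (Y (x $ 1))\<^sup>2 * (f (x $ 3))\<^sup>2"
  by (simp_all add: gks_metric_def)

lemma partial_gks_metric:
  fixes X Y f :: "real \<Rightarrow> real" and x :: "real ^ 4"
  assumes X: "X differentiable at (x $ 1)" and Y: "Y differentiable at (x $ 1)" and f: "f differentiable at (x $ 3)"
  shows "partial k (\<lambda>y. gks_metric X Y f y $ 1 $ 1) x = 0"
    and "partial k (\<lambda>y. gks_metric X Y f y $ 2 $ 2) x = (if k = 1 then - 2 * (deriv X (x $ 1) * X (x $ 1)) else 0)"
    and "partial k (\<lambda>y. gks_metric X Y f y $ 3 $ 3) x = (if k = 1 then - 2 * (deriv Y (x $ 1) * Y (x $ 1)) else 0)"
    and "partial k (\<lambda>y. gks_metric X Y f y $ 4 $ 4) x =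
      (if k = 1 then - 2 * (deriv Y (x $ 1) * Y (x $ 1)) * (f (x $ 3))\<^sup>2
       else if k = 3 then - 2 * (Y (x $ 1))\<^sup>2 * (f (x $ 3) * deriv f (x $ 3)) else 0)"
proof -
  have D: "((\<lambda>y. H (y $ i)) has_derivative (\<lambda>v. deriv H (x $ i) * v $ i)) (at x)"
    if "H differentiable at (x $ i)" for H :: "real \<Rightarrow> real" and i
  proof -
    have "(H has_derivative (\<lambda>s. deriv H (x $ i) * s)) (at (x $ i))"
      using that by (simp add: DERIV_deriv_iff_real_differentiable flip: has_field_derivative_def)
    moreover have "((\<lambda>y. y $ i) has_derivative (\<lambda>v. v $ i)) (at x)"
      by (simp add: bounded_linear_imp_has_derivative bounded_linear_vec_nth)
    ultimately show ?thesis
      using diff_chain_at[of "\<lambda>y. y $ i" "\<lambda>v. v $ i" x H] by (simp add: o_def)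
  qed
  note entry = gks_metric_entries partial_def
  show "partial k (\<lambda>y. gks_metric X Y f y $ 1 $ 1) x = 0"
    by (simp add: entry)
  have "((\<lambda>y. - (X (y $ 1))\<^sup>2) has_derivative (\<lambda>v. - 2 * (deriv X (x $ 1) * X (x $ 1)) * v $ 1)) (at x)"
    by (auto intro!: derivative_eq_intros D X)
  from D_eq[OF this]
  show "partial k (\<lambda>y. gks_metric X Y f y $ 2 $ 2) x = (if k = 1 then - 2 * (deriv X (x $ 1) * X (x $ 1)) else 0)"
    by (simp add: entry axis_def)
  have "((\<lambda>y. - (Y (y $ 1))\<^sup>2) has_derivative (\<lambda>v. - 2 * (deriv Y (x $ 1) * Y (x $ 1)) * v $ 1)) (at x)"
    by (auto intro!: derivative_eq_intros D Y)
  from D_eq[OF this]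
  show "partial k (\<lambda>y. gks_metric X Y f y $ 3 $ 3) x = (if k = 1 then - 2 * (deriv Y (x $ 1) * Y (x $ 1)) else 0)"
    by (simp add: entry axis_def)
  have "((\<lambda>y. - (Y (y $ 1))\<^sup>2 * (f (y $ 3))\<^sup>2) has_derivative
      (\<lambda>v. - 2 * (deriv Y (x $ 1) * Y (x $ 1)) * (f (x $ 3))\<^sup>2 * v $ 1
           - 2 * (Y (x $ 1))\<^sup>2 * (f (x $ 3) * deriv f (x $ 3)) * v $ 3)) (at x)"
    by (auto intro!: derivative_eq_intros D Y f simp: algebra_simps)
  from D_eq[OF this]
  show "partial k (\<lambda>y. gks_metric X Y f y $ 4 $ 4) x =
      (if k = 1 then - 2 * (deriv Y (x $ 1) * Y (x $ 1)) * (f (x $ 3))\<^sup>2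
       else if k = 3 then - 2 * (Y (x $ 1))\<^sup>2 * (f (x $ 3) * deriv f (x $ 3)) else 0)"
    by (auto simp: entry axis_def)
qed

lemma christoffel_gks_metric:
  fixes X Y f :: "real \<Rightarrow> real" and x :: "real ^ 4"
  assumes inv: "invertible (gks_metric X Y f x)"
    and X: "X differentiable at (x $ 1)" and Y: "Y differentiable at (x $ 1)" and f: "f differentiable at (x $ 3)"
  shows "christoffel (gks_metric X Y f) 1 1 1 x = 0"
    and "christoffel (gks_metric X Y f) 1 2 2 x = deriv X (x $ 1) * X (x $ 1)"
    and "christoffel (gks_metric X Y f) 1 3 3 x = deriv Y (x $ 1) * Y (x $ 1)"
    and "christoffel (gks_metric X Y f) 1 4 4 x = deriv Y (x $ 1) * Y (x $ 1) * (f (x $ 3))\<^sup>2"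
    and "christoffel (gks_metric X Y f) 2 i i x = 0"
    and "christoffel (gks_metric X Y f) 3 1 1 x = 0"
    and "christoffel (gks_metric X Y f) 3 2 2 x = 0"
    and "christoffel (gks_metric X Y f) 3 3 3 x = 0"
    and "christoffel (gks_metric X Y f) 3 4 4 x = - f (x $ 3) * deriv f (x $ 3)"
    and "christoffel (gks_metric X Y f) 4 i i x = 0"
proof -
  have nz: "Y (x $ 1) \<noteq> 0"
    using matrix_inv_diagonal(1)[OF inv gks_metric_entries(1), of 3] by (simp add: gks_metric_entries)
  note C = christoffel_diagonal[of "gks_metric X Y f", OF inv gks_metric_entries(1)]
  note P = C gks_metric_entries(2)[of X Y f x] gks_metric_entries(3)[of X Y f x]
    gks_metric_entries(4)[of X Y f x] gks_metric_entries(5)[of X Y f x] partial_gks_metric[OF X Y f]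
  show "christoffel (gks_metric X Y f) 1 1 1 x = 0"
    "christoffel (gks_metric X Y f) 1 2 2 x = deriv X (x $ 1) * X (x $ 1)"
    "christoffel (gks_metric X Y f) 1 3 3 x = deriv Y (x $ 1) * Y (x $ 1)"
    "christoffel (gks_metric X Y f) 1 4 4 x = deriv Y (x $ 1) * Y (x $ 1) * (f (x $ 3))\<^sup>2"
    "christoffel (gks_metric X Y f) 3 1 1 x = 0"
    "christoffel (gks_metric X Y f) 3 2 2 x = 0"
    "christoffel (gks_metric X Y f) 3 3 3 x = 0"
    by (simp_all add: P)
  show "christoffel (gks_metric X Y f) 3 4 4 x = - f (x $ 3) * deriv f (x $ 3)"
    using nz by (simp add: P)
  show "christoffel (gks_metric X Y f) 2 i i x = 0" "christoffel (gks_metric X Y f) 4 i i x = 0"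
    using exhaust_4[of i] by (auto simp: P)
qed

lemma tension_field_gks_metric_eq_0_iff:
  fixes X Y f Xh Yh fh :: "real \<Rightarrow> real" and x :: "real ^ 4"
  defines "t \<equiv> x $ 1" and "\<theta> \<equiv> x $ 3"
  assumes inv: "invertible (gks_metric X Y f x)" "invertible (gks_metric Xh Yh fh x)"
    and diff: "X differentiable at t" "Y differentiable at t" "f differentiable at \<theta>"
    and diffh: "Xh differentiable at t" "Yh differentiable at t" "fh differentiable at \<theta>"
  shows "tension_field (gks_metric X Y f) (gks_metric Xh Yh fh) (\<lambda>x. x) x = 0 \<longleftrightarrow>
       1 / (X t)\<^sup>2 * (deriv Xh t * Xh t - deriv X t * X t)
       + 1 / (Y t)\<^sup>2 * (deriv Yh t * Yh t - deriv Y t * Y t)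
       + 1 / ((Y t)\<^sup>2 * (f \<theta>)\<^sup>2) * (deriv Yh t * Yh t * (fh \<theta>)\<^sup>2 - deriv Y t * Y t * (f \<theta>)\<^sup>2) = 0
     \<and> - fh \<theta> * deriv fh \<theta> + f \<theta> * deriv f \<theta> = 0"
    (is "?\<tau> = 0 \<longleftrightarrow> ?E1 = 0 \<and> ?E3 = 0")
proof -
  \<comment> \<open>Up to sign this is the \<open>\<phi>\<phi>\<close> entry of an invertible diagonal matrix.\<close>
  have nz: "(Y t)\<^sup>2 * (f \<theta>)\<^sup>2 \<noteq> 0"
    using matrix_inv_diagonal(1)[OF inv(1) gks_metric_entries(1), of 4] by (simp add: gks_metric_entries t_def \<theta>_def)
  note C = christoffel_gks_metric[OF inv(1) diff[unfolded t_def \<theta>_def]]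
    christoffel_gks_metric[OF inv(2) diffh[unfolded t_def \<theta>_def]]
  have \<tau>: "?\<tau> $ c = (\<Sum>i\<in>UNIV. (christoffel (gks_metric Xh Yh fh) c i i x
      - christoffel (gks_metric X Y f) c i i x) / gks_metric X Y f x $ i $ i)" for c
    by (rule tension_field_identity_diagonal[of "gks_metric X Y f" x, OF inv(1) gks_metric_entries(1)])
  have "?\<tau> $ 1 = - ?E1"
    by (simp add: \<tau> sum_4 C gks_metric_entries t_def \<theta>_def)
  moreover have "?\<tau> $ 2 = 0" "?\<tau> $ 4 = 0"
    by (simp_all add: \<tau> C)
  moreover have "?\<tau> $ 3 = - (?E3 / ((Y t)\<^sup>2 * (f \<theta>)\<^sup>2))"
    by (simp add: \<tau> sum_4 C gks_metric_entries t_def \<theta>_def)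
  ultimately have "?\<tau> = 0 \<longleftrightarrow> - ?E1 = 0 \<and> - (?E3 / ((Y t)\<^sup>2 * (f \<theta>)\<^sup>2)) = 0"
    unfolding vec_eq_iff forall_4 by simp
  then show ?thesis
    unfolding neg_equal_0_iff_equal divide_eq_0_iff using nz by blast
qed

theorem theorem5:
  fixes U :: "(real ^ 4) set"
    and X Y f Xh Yh fh :: "real \<Rightarrow> real"
    and CG CGh :: "real ^ (4 + 4) \<Rightarrow> real ^ (4 + 4) ^ (4 + 4)"
  assumes "open U"
    and "smooth_on ((\<lambda>x. x $ 1) ` U) X" and "smooth_on ((\<lambda>x. x $ 1) ` U) Y"
    and "smooth_on ((\<lambda>x. x $ 3) ` U) f"
    and "smooth_on ((\<lambda>x. x $ 1) ` U) Xh" and "smooth_on ((\<lambda>x. x $ 1) ` U) Yh"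
    and "smooth_on ((\<lambda>x. x $ 3) ` U) fh"
    and "pseudo_riemannian_on U (gks_metric X Y f)"
    and "pseudo_riemannian_on U (gks_metric Xh Yh fh)"
    and "is_complete_lift_metric U (gks_metric X Y f) CG"
    and "is_complete_lift_metric U (gks_metric Xh Yh fh) CGh"
  shows "harmonic_metric_on (tangent_bundle U) CG CGh \<longleftrightarrow>
    (\<forall>x\<in>U. let t = x $ 1; \<theta> = x $ 3 in
       1 / (X t)\<^sup>2 * (deriv Xh t * Xh t - deriv X t * X t)
       + 1 / (Y t)\<^sup>2 * (deriv Yh t * Yh t - deriv Y t * Y t)
       + 1 / ((Y t)\<^sup>2 * (f \<theta>)\<^sup>2) * (deriv Yh t * Yh t * (fh \<theta>)\<^sup>2 - deriv Y t * Y t * (f \<theta>)\<^sup>2) = 0) \<and>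
    (\<forall>x\<in>U. let \<theta> = x $ 3 in - fh \<theta> * deriv fh \<theta> + f \<theta> * deriv f \<theta> = 0)"
proof -
  have "harmonic_metric_on (tangent_bundle U) CG CGh \<longleftrightarrow>
      (\<forall>x\<in>U. tension_field (gks_metric X Y f) (gks_metric Xh Yh fh) (\<lambda>x. x) x = 0)"
    using harmonic_complete_lift_iff[OF assms(1,8-11)]
    by (simp add: harmonic_metric_on_def harmonic_map_on_def)
  also have "\<dots> \<longleftrightarrow> (\<forall>x\<in>U. let t = x $ 1; \<theta> = x $ 3 in
       1 / (X t)\<^sup>2 * (deriv Xh t * Xh t - deriv X t * X t)
       + 1 / (Y t)\<^sup>2 * (deriv Yh t * Yh t - deriv Y t * Y t)
       + 1 / ((Y t)\<^sup>2 * (f \<theta>)\<^sup>2) * (deriv Yh t * Yh t * (fh \<theta>)\<^sup>2 - deriv Y t * Y t * (f \<theta>)\<^sup>2) = 0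
       \<and> - fh \<theta> * deriv fh \<theta> + f \<theta> * deriv f \<theta> = 0)"
  proof (rule ball_cong[OF refl])
    fix x assume x: "x \<in> U"
    have inv: "invertible (gks_metric X Y f x)" "invertible (gks_metric Xh Yh fh x)"
      using assms(8,9) x by (simp_all add: pseudo_riemannian_on_def)
    have "H differentiable at (x $ i)" if "smooth_on ((\<lambda>x. x $ i) ` U) H" for H :: "real \<Rightarrow> real" and i
      using smooth_on_differentiable[OF that] x by blast
    note diff = this[OF assms(2)] this[OF assms(3)] this[OF assms(4)] this[OF assms(5)] this[OF assms(6)] this[OF assms(7)]
    show "tension_field (gks_metric X Y f) (gks_metric Xh Yh fh) (\<lambda>x. x) x = 0 \<longleftrightarrow> (let t = x $ 1; \<theta> = x $ 3 in
       1 / (X t)\<^sup>2 * (deriv Xh t * Xh t - deriv X t * X t)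
       + 1 / (Y t)\<^sup>2 * (deriv Yh t * Yh t - deriv Y t * Y t)
       + 1 / ((Y t)\<^sup>2 * (f \<theta>)\<^sup>2) * (deriv Yh t * Yh t * (fh \<theta>)\<^sup>2 - deriv Y t * Y t * (f \<theta>)\<^sup>2) = 0
       \<and> - fh \<theta> * deriv fh \<theta> + f \<theta> * deriv f \<theta> = 0)"
      unfolding Let_def by (rule tension_field_gks_metric_eq_0_iff[OF inv diff])
  qed
  finally show ?thesis
    by (simp add: Let_def ball_conj_distrib)
qed

end
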